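(* Let $Q(k) = 60k^2-43k+8$. We have $$\sum_{k=1}^\infty \frac{\binom{4k}{2k} \big( Q(k) (3H_{2k-1}-2H_{k-1}) -34k+25/2 \big) }{(4k-1)k^3\binom{2k}{k}^4} = 6 \zeta(3),$$ $$\sum_{k=1}^\infty \frac{\binom{4k}{2k} \big( Q(k) H_{4k-1} -(304k^2-216k+39)/(4(4k-1)) \big) }{(4k-1)k^3\binom{2k}{k}^4} = 4 \zeta(3),$$ $$\sum_{k=1}^\infty \frac{\binom{4k}{2k} \big( Q(k) H_{k-1}^{(2)} +(44k-15)/(4k) \big) }{(4k-1)k^3\binom{2k}{k}^4} = \frac{\pi^4}{90},$$ and $$\sum_{k=1}^\infty \frac{\binom{4k}{2k} \big( Q(k) H_{2k-1}^{(2)} +(52k-21)/(4k) \big) }{(4k-1)k^3\binom{2k}{k}^4} = \frac{2\pi^4}{45}.$$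
   Context: For integers $m\ge1$ and $n\ge0$, $H_n^{(m)}=\sum_{0<j\le n}\frac1{j^m}$ denotes the harmonic number of order $m$, and $H_n=H_n^{(1)}$ (so $H_0=H_0^{(m)}=0$). $\zeta$ is the Riemann zeta function. *)

theory Defs
  imports "HOL-Analysis.Analysis"
begin

definition gen_harm :: "nat \<Rightarrow> nat \<Rightarrow> real" where
  "gen_harm m n = (\<Sum>j=1..n. 1 / real j ^ m)"

lemma gen_harm_1: "gen_harm 1 n = harm n"
  by (simp add: gen_harm_def harm_def inverse_eq_divide)

text \<open>
  The Riemann zeta function on the real half-line \<open>s > 1\<close>, where it is given by its Dirichlet
  series; for \<open>s \<le> 1\<close> the series diverges and the value is unspecified.
\<close>
definition zeta :: "real \<Rightarrow> real" where
  "zeta s = (\<Sum>n. 1 / real (Suc n) powr s)"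

definition Q :: "nat \<Rightarrow> real" where
  "Q k = 60 * real k ^ 2 - 43 * real k + 8"

end

theory Submission
  imports Defs "HOL-Real_Asymp.Real_Asymp"
begin

text \<open>
  All four series are Taylor coefficients at \<open>\<theta> = 0\<close> of a single identity with five parameters
  \<open>\<theta> = (a, b, c, d, e)\<close>. It equates a slowly convergent well-poised series, row 0 of an array, with a series
  converging like \<open>16\<^bsup>-n\<^esup>\<close>, read off from column 0. At \<open>\<theta> = 0\<close> it reads
  \<open>\<Sum> 2 / k\<^sup>2 = \<Sum> w\<^sub>k Q(k)\<close>, where \<open>w\<^sub>k\<close> is the hypergeometric weight of the theorem. Every entry is a quotient of
  shifted factorials whose arguments are linear in \<open>\<theta>\<close>. Differentiating at 0 therefore produces
  harmonic numbers: a first derivative gives numbers of order 1 and a value \<open>\<zeta>(3)\<close>, and a second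
  derivative, taken so that products of harmonic numbers cancel, gives numbers of order 2 and \<open>\<zeta>(4)\<close>.

  The identity comes from a Wilf-Zeilberger relation
  \<open>F(n+1, k) - F(n, k+1) = M(n, k+1) - M(n, k)\<close> (\<open>wz_identity\<close>), which reduces to a polynomial identity in
  five variables (\<open>certificate_identity\<close>). This relation has finitely many terms, so it can be differentiated in
  \<open>\<theta>\<close> without any analysis of convergence, and it keeps its shape. Summation over \<open>n\<close> and \<open>k\<close> is done
  afterwards, at \<open>\<theta> = 0\<close> only, where the derivatives are bounded by a constant times the terms themselves times the
  square of a harmonic number (\<open>first_order_transfer\<close>, \<open>second_order_transfer\<close>).

  Four choices of directions give four equations for the four series. In each of them the
  differentiated row 0 has to be summed independently: twice it is a multiple of \<open>\<Sum> 1 / k\<^sup>r\<close>, and in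
  the other two cases it is a combination of Euler sums such as \<open>\<Sum> H\<^bsub>k-1\<^esub> / k\<^sup>3\<close>. These are found, together
  with \<open>\<zeta>(4) = \<pi>\<^sup>4 / 90\<close>, from Cauchy squares of \<open>\<Sum> 1 / k\<^sup>2\<close> and of its half-integer analogue and from summing
  \<open>1 / (p q\<^sup>s (p + q))\<close> by rows and by diagonals (\<open>euler_sum_2\<close>, \<open>euler_sums_4\<close>, \<open>odd_euler_sum\<close>).
\<close>

section \<open>Quotients of shifted factorials and their derivatives\<close>

type_synonym params = "real \<times> real \<times> real \<times> real \<times> real"
text \<open>
  A triple \<open>(c, l, m)\<close> stands for the shifted factorial \<open>(c + l \<bullet> \<theta>)\<^sub>m\<close> as a function of the parameter
  vector \<open>\<theta>\<close>, and a pair of lists for the quotient of two products of such factors. With products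
  kept as data, differentiation and estimation are list inductions done once, and the two families of
  terms used below only have to be written down. A single linear factor is a shifted factorial of
  length 1.
\<close>
type_synonym factor = "real \<times> params \<times> nat"
type_synonym quot = "factor list \<times> factor list"

text \<open>
  \<open>recip_sum 1 m x\<close> is the logarithmic derivative of \<open>pochhammer x m\<close> in \<open>x\<close>, and \<open>recip_sum 2 m x\<close> is minus
  the derivative of that. At \<open>x = 1\<close> they are harmonic numbers.
\<close>
definition recip_sum :: "nat \<Rightarrow> nat \<Rightarrow> real \<Rightarrow> real" where
  "recip_sum r m x = (\<Sum>j<m. 1 / (x + real j) ^ r)"

definition prodval :: "factor list \<Rightarrow> params \<Rightarrow> real" where
  "prodval xs \<theta> = (\<Prod>(c, l, m)\<leftarrow>xs. pochhammer (c + l \<bullet> \<theta>) m)"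
definition dlogs :: "factor list \<Rightarrow> params \<Rightarrow> params \<Rightarrow> real" where
  "dlogs xs \<theta> p = (\<Sum>(c, l, m)\<leftarrow>xs. (l \<bullet> p) * recip_sum 1 m (c + l \<bullet> \<theta>))"
definition ddlogs :: "factor list \<Rightarrow> params \<Rightarrow> params \<Rightarrow> params \<Rightarrow> real" where
  "ddlogs xs \<theta> p q = - (\<Sum>(c, l, m)\<leftarrow>xs. (l \<bullet> p) * (l \<bullet> q) * recip_sum 2 m (c + l \<bullet> \<theta>))"
definition admissible :: "factor list \<Rightarrow> params \<Rightarrow> bool" where
  "admissible xs \<theta> = (\<forall>(c, l, m)\<in>set xs. 0 < c + l \<bullet> \<theta>)"

definition val :: "quot \<Rightarrow> params \<Rightarrow> real" where
  "val X \<theta> = prodval (fst X) \<theta> / prodval (snd X) \<theta>"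
definition dlog :: "quot \<Rightarrow> params \<Rightarrow> params \<Rightarrow> real" where
  "dlog X \<theta> p = dlogs (fst X) \<theta> p - dlogs (snd X) \<theta> p"
definition ddlog :: "quot \<Rightarrow> params \<Rightarrow> params \<Rightarrow> params \<Rightarrow> real" where
  "ddlog X \<theta> p q = ddlogs (fst X) \<theta> p q - ddlogs (snd X) \<theta> p q"
definition regular :: "quot \<Rightarrow> params \<Rightarrow> bool" where
  "regular X \<theta> = (admissible (fst X) \<theta> \<and> admissible (snd X) \<theta>)"

lemma pochhammer_has_derivative:
  fixes x h :: real
  assumes "0 < x"
  shows "((\<lambda>s. pochhammer (x + s * h) m) has_real_derivative
           pochhammer x m * (h * recip_sum 1 m x)) (at 0)"
proof (induction m)
  case 0
  then show ?case by (simp add: recip_sum_def)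
next
  case (Suc m)
  have nz: "x + real m \<noteq> 0" using assms by simp
  have "((\<lambda>s. pochhammer (x + s * h) m * (x + s * h + real m)) has_real_derivative
          pochhammer x m * (h * recip_sum 1 m x) * (x + real m) + h * pochhammer x m) (at 0)"
    by (rule derivative_eq_intros Suc refl)+ simp
  moreover have "pochhammer x m * (h * recip_sum 1 m x) * (x + real m) + h * pochhammer x m
      = pochhammer x (Suc m) * (h * recip_sum 1 (Suc m) x)"
    using nz by (simp add: pochhammer_Suc recip_sum_def field_simps)
  ultimately show ?case by (simp add: pochhammer_Suc)
qed

lemma recip_sum_has_derivative:
  fixes x h :: real
  assumes "0 < x"
  shows "((\<lambda>s. recip_sum 1 m (x + s * h)) has_real_derivative - h * recip_sum 2 m x) (at 0)"
proof -
  have "((\<lambda>s. \<Sum>j<m. 1 / (x + s * h + real j) ^ 1) has_real_derivative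
          (\<Sum>j<m. - h * (1 / (x + real j) ^ 2))) (at 0)"
  proof (rule DERIV_sum)
    fix j
    have nz: "x + 0 * h + real j \<noteq> 0" using assms by simp
    show "((\<lambda>s. 1 / (x + s * h + real j) ^ 1) has_real_derivative - h * (1 / (x + real j) ^ 2)) (at 0)"
      using nz by (auto intro!: derivative_eq_intros simp: power2_eq_square)
  qed
  then show ?thesis by (simp add: recip_sum_def sum_distrib_left)
qed

lemma prodval_pos: "admissible xs \<theta> \<Longrightarrow> 0 < prodval xs \<theta>"
  by (induction xs) (auto simp: admissible_def prodval_def intro!: mult_pos_pos pochhammer_pos)

lemma prodval_has_derivative:
  assumes "admissible xs \<theta>"
  shows "((\<lambda>s. prodval xs (\<theta> + s *\<^sub>R p)) has_real_derivative prodval xs \<theta> * dlogs xs \<theta> p) (at 0)"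
  using assms
proof (induction xs)
  case Nil
  then show ?case by (simp add: prodval_def dlogs_def)
next
  case (Cons x xs)
  obtain c l m where x: "x = (c, l, m)" by (cases x) auto
  from Cons.prems have pos: "0 < c + l \<bullet> \<theta>" and "admissible xs \<theta>"
    by (auto simp: admissible_def x)
  note IH = Cons.IH[OF this(2)]
  have ev: "prodval (x # xs) \<theta>' = pochhammer (c + l \<bullet> \<theta>') m * prodval xs \<theta>'" for \<theta>'
    by (simp add: prodval_def x)
  have P: "((\<lambda>s. pochhammer (c + l \<bullet> (\<theta> + s *\<^sub>R p)) m) has_real_derivative
             pochhammer (c + l \<bullet> \<theta>) m * ((l \<bullet> p) * recip_sum 1 m (c + l \<bullet> \<theta>))) (at 0)"
    using pochhammer_has_derivative[OF pos, of "l \<bullet> p" m]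
    by (simp add: inner_add_right add.assoc)
  have "((\<lambda>s. pochhammer (c + l \<bullet> (\<theta> + s *\<^sub>R p)) m * prodval xs (\<theta> + s *\<^sub>R p)) has_real_derivative
      pochhammer (c + l \<bullet> \<theta>) m * ((l \<bullet> p) * recip_sum 1 m (c + l \<bullet> \<theta>)) * prodval xs \<theta>
       + prodval xs \<theta> * dlogs xs \<theta> p * pochhammer (c + l \<bullet> \<theta>) m) (at 0)"
    using DERIV_mult[OF P IH] by simp
  then show ?case
    unfolding ev by (simp add: dlogs_def x algebra_simps)
qed

lemma dlogs_has_derivative:
  assumes "admissible xs \<theta>"
  shows "((\<lambda>s. dlogs xs (\<theta> + s *\<^sub>R q) p) has_real_derivative ddlogs xs \<theta> p q) (at 0)"
  using assms
proof (induction xs)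
  case Nil
  then show ?case by (simp add: ddlogs_def dlogs_def)
next
  case (Cons x xs)
  obtain c l m where x: "x = (c, l, m)" by (cases x) auto
  from Cons.prems have pos: "0 < c + l \<bullet> \<theta>" and "admissible xs \<theta>"
    by (auto simp: admissible_def x)
  note IH = Cons.IH[OF this(2)]
  have P: "((\<lambda>s. recip_sum 1 m (c + l \<bullet> (\<theta> + s *\<^sub>R q))) has_real_derivative
             - (l \<bullet> q) * recip_sum 2 m (c + l \<bullet> \<theta>)) (at 0)"
    using recip_sum_has_derivative[OF pos, of m "l \<bullet> q"]
    by (simp add: inner_add_right add.assoc)
  have "((\<lambda>s. (l \<bullet> p) * recip_sum 1 m (c + l \<bullet> (\<theta> + s *\<^sub>R q)) + dlogs xs (\<theta> + s *\<^sub>R q) p)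
     has_real_derivative (l \<bullet> p) * (- (l \<bullet> q) * recip_sum 2 m (c + l \<bullet> \<theta>)) + ddlogs xs \<theta> p q) (at 0)"
    by (intro DERIV_add DERIV_cmult P IH)
  then show ?case by (simp add: dlogs_def ddlogs_def x algebra_simps)
qed

lemma val_has_derivative:
  assumes "regular X \<theta>"
  shows "((\<lambda>s. val X (\<theta> + s *\<^sub>R p)) has_real_derivative val X \<theta> * dlog X \<theta> p) (at 0)"
proof -
  have N: "((\<lambda>s. prodval (fst X) (\<theta> + s *\<^sub>R p)) has_real_derivative
             prodval (fst X) \<theta> * dlogs (fst X) \<theta> p) (at 0)"
   and D: "((\<lambda>s. prodval (snd X) (\<theta> + s *\<^sub>R p)) has_real_derivative
             prodval (snd X) \<theta> * dlogs (snd X) \<theta> p) (at 0)"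
    using assms by (auto simp: regular_def intro: prodval_has_derivative)
  have nz: "prodval (snd X) \<theta> \<noteq> 0"
    using assms prodval_pos[of "snd X" \<theta>] by (simp add: regular_def)
  show ?thesis
    unfolding val_def
    by (rule DERIV_cong[OF DERIV_divide[OF N D]])
       (use nz in \<open>simp_all add: dlog_def field_simps\<close>)
qed

lemma dlog_has_derivative:
  assumes "regular X \<theta>"
  shows "((\<lambda>s. dlog X (\<theta> + s *\<^sub>R q) p) has_real_derivative ddlog X \<theta> p q) (at 0)"
  using assms unfolding dlog_def ddlog_def regular_def
  by (intro DERIV_diff dlogs_has_derivative) auto

lemma eventually_admissible:
  assumes "admissible xs \<theta>"
  shows "\<forall>\<^sub>F s in nhds 0. admissible xs (\<theta> + s *\<^sub>R q)"
proof -
  have "\<forall>\<^sub>F s in nhds (0::real). 0 < c + l \<bullet> (\<theta> + s *\<^sub>R q)" if "0 < c + l \<bullet> \<theta>" for c and l :: params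
  proof -
    have "((\<lambda>s. c + l \<bullet> (\<theta> + s *\<^sub>R q)) \<longlongrightarrow> c + l \<bullet> (\<theta> + 0 *\<^sub>R q)) (nhds 0)"
      by (intro tendsto_intros filterlim_ident)
    then show ?thesis using that by (auto dest: order_tendstoD(1))
  qed
  then show ?thesis
    using assms unfolding admissible_def
    by (intro eventually_ball_finite) auto
qed

lemma eventually_regular:
  assumes "regular X \<theta>"
  shows "\<forall>\<^sub>F s in nhds 0. regular X (\<theta> + s *\<^sub>R q)"
  using assms unfolding regular_def by (auto intro: eventually_conj eventually_admissible)

definition deriv1 :: "quot \<Rightarrow> params \<Rightarrow> params \<Rightarrow> real" where
  "deriv1 X \<theta> p = val X \<theta> * dlog X \<theta> p"
definition deriv2 :: "quot \<Rightarrow> params \<Rightarrow> params \<Rightarrow> params \<Rightarrow> real" where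
  "deriv2 X \<theta> p q = val X \<theta> * (dlog X \<theta> p * dlog X \<theta> q + ddlog X \<theta> p q)"

lemma deriv1_has_derivative:
  assumes "regular X \<theta>"
  shows "((\<lambda>s. deriv1 X (\<theta> + s *\<^sub>R q) p) has_real_derivative deriv2 X \<theta> p q) (at 0)"
  unfolding deriv1_def
  by (rule DERIV_cong[OF DERIV_mult[OF val_has_derivative[OF assms] dlog_has_derivative[OF assms]]])
     (simp add: deriv2_def algebra_simps)

text \<open>
  A linear relation that holds near \<open>\<theta>\<close> can be differentiated along \<open>q\<close>. Used twice, it turns the
  relation between the values of four quotients into the same relation between their first and then
  their mixed second directional derivatives.
\<close>
lemma derivative_relation:
  assumes D: "\<And>X. X \<in> {X1, X2, X3, X4} \<Longrightarrow>
        ((\<lambda>s. f X (\<theta> + s *\<^sub>R q)) has_real_derivative f' X) (at 0)"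
    and ev: "\<forall>\<^sub>F s in nhds (0::real). f X1 (\<theta> + s *\<^sub>R q) - f X2 (\<theta> + s *\<^sub>R q)
                 = f X3 (\<theta> + s *\<^sub>R q) - f X4 (\<theta> + s *\<^sub>R q)"
  shows "f' X1 - f' X2 = f' X3 - (f' X4 :: real)"
proof -
  have "((\<lambda>s. f X1 (\<theta> + s *\<^sub>R q) - f X2 (\<theta> + s *\<^sub>R q)) has_real_derivative f' X1 - f' X2) (at 0)"
    by (intro DERIV_diff D) auto
  then have "((\<lambda>s. f X3 (\<theta> + s *\<^sub>R q) - f X4 (\<theta> + s *\<^sub>R q)) has_real_derivative f' X1 - f' X2) (at 0)"
    using DERIV_cong_ev[OF refl ev refl] by simp
  moreover have "((\<lambda>s. f X3 (\<theta> + s *\<^sub>R q) - f X4 (\<theta> + s *\<^sub>R q)) has_real_derivative f' X3 - f' X4) (at 0)"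
    by (intro DERIV_diff D) auto
  ultimately show ?thesis by (rule DERIV_unique)
qed

section \<open>The five-parameter telescoping identity\<close>

text \<open>
  Up to a factor independent of \<open>k\<close>, \<open>main_term n k\<close> is the \<open>k\<close>-th term
  \<open>A (B)\<^sub>k (C)\<^sub>k (D)\<^sub>k (E)\<^sub>k\<close> over \<open>(1+A-B)\<^sub>k (1+A-C)\<^sub>k (1+A-D)\<^sub>k (1+A-E)\<^sub>k\<close>, with \<open>A\<close> in front raised by
  \<open>2k\<close>, of the well-poised series with parameters
  \<open>(A, B, C, D, E) = (2+a+3n, 1+b+n, 1+c+n, 1+d+n, 3/2+e+2n)\<close>. The factor is the one that makes a step in
  \<open>n\<close> telescope in \<open>k\<close>. The lengths of the factor with \<open>e\<close> above and of the four factors below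
  whose length depends on \<open>k\<close> are one larger than in that series, which changes the term by a quantity
  depending on \<open>\<theta>\<close> only. With this normalisation the first derivatives of column 0 along
  \<open>(1, 1, 1, 1, 0)\<close> cancel, which keeps the second derivatives in \<open>column_mixed\<close> simple.
\<close>
definition main_term :: "nat \<Rightarrow> nat \<Rightarrow> quot" where
  "main_term n k =
    ([(2 + 3 * real n + 2 * real k, (1, 0, 0, 0, 0), 1),
      (1, (0, 1, 0, 0, 0), n + k), (1, (0, 0, 1, 0, 0), n + k), (1, (0, 0, 0, 1, 0), n + k),
      (1 / 2, (0, 0, 0, 0, 1), 2 * n + k + 1),
      (1, (1, - 1, - 1, 0, 0), n), (1, (1, - 1, 0, - 1, 0), n), (1, (1, 0, - 1, - 1, 0), n)],
     [(1, (1, - 1, 0, 0, 0), 2 * n + k + 1), (1, (1, 0, - 1, 0, 0), 2 * n + k + 1),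
      (1, (1, 0, 0, - 1, 0), 2 * n + k + 1), (1 / 2, (1, 0, 0, 0, - 1), n + k + 1),
      (1 / 2, (2, - 1, - 1, - 1, - 1), n)])"

definition carry_term :: "nat \<Rightarrow> nat \<Rightarrow> quot" where
  "carry_term n k =
    ([(3 + 3 * real n + real k, (2, - 1, - 1, - 1, 0), 1),
      (1, (0, 1, 0, 0, 0), n + k + 1), (1, (0, 0, 1, 0, 0), n + k + 1),
      (1, (0, 0, 0, 1, 0), n + k + 1), (1 / 2, (0, 0, 0, 0, 1), 2 * n + k + 2),
      (1, (1, - 1, - 1, 0, 0), n), (1, (1, - 1, 0, - 1, 0), n), (1, (1, 0, - 1, - 1, 0), n)],
     [(1, (1, - 1, 0, 0, 0), 2 * n + k + 2), (1, (1, 0, - 1, 0, 0), 2 * n + k + 2),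
      (1, (1, 0, 0, - 1, 0), 2 * n + k + 2), (1 / 2, (1, 0, 0, 0, - 1), n + k + 1),
      (1 / 2, (2, - 1, - 1, - 1, - 1), n + 1)])"

text \<open>
  The telescoping relation with all common shifted factorials divided out. Here \<open>A = 2 + a + 3n + 2k\<close>,
  \<open>B = 1 + b + n + k\<close> and so on; \<open>n\<close> and \<open>k\<close> enter only through these five quantities, because the
  combinations such as \<open>1 + A - B - C\<close> and \<open>X\<close> do not change with \<open>k\<close>.
\<close>
lemma certificate_identity:
  fixes A B C D E :: real
  defines "X \<equiv> 1 + 2 * A - B - C - D - E"
  shows "(A + 3) * (E + 1) * (1 + A - B - C) * (1 + A - B - D) * (1 + A - C - D)
      - (A + 2) * (2 + A - B) * (2 + A - C) * (2 + A - D) * X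
    = (B + 1) * (C + 1) * (D + 1) * (E + 1) * (3 + 2 * A - B - C - D)
      - (2 + 2 * A - B - C - D) * (2 + A - B) * (2 + A - C) * (2 + A - D) * (1 + A - E)"
  unfolding X_def by algebra

lemma inner_forms:
  fixes a b c d e :: real
  shows "(1, 0, 0, 0, 0) \<bullet> (a, b, c, d, e) = a" "(0, 1, 0, 0, 0) \<bullet> (a, b, c, d, e) = b"
    "(0, 0, 1, 0, 0) \<bullet> (a, b, c, d, e) = c" "(0, 0, 0, 1, 0) \<bullet> (a, b, c, d, e) = d"
    "(0, 0, 0, 0, 1) \<bullet> (a, b, c, d, e) = e"
    "(1, - 1, 0, 0, 0) \<bullet> (a, b, c, d, e) = a - b" "(1, 0, - 1, 0, 0) \<bullet> (a, b, c, d, e) = a - c"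
    "(1, 0, 0, - 1, 0) \<bullet> (a, b, c, d, e) = a - d" "(1, 0, 0, 0, - 1) \<bullet> (a, b, c, d, e) = a - e"
    "(1, - 1, - 1, 0, 0) \<bullet> (a, b, c, d, e) = a - b - c"
    "(1, - 1, 0, - 1, 0) \<bullet> (a, b, c, d, e) = a - b - d"
    "(1, 0, - 1, - 1, 0) \<bullet> (a, b, c, d, e) = a - c - d"
    "(2, - 1, - 1, - 1, 0) \<bullet> (a, b, c, d, e) = 2 * a - b - c - d"
    "(2, - 1, - 1, - 1, - 1) \<bullet> (a, b, c, d, e) = 2 * a - b - c - d - e"
  by simp_all

lemma val_main:
  "val (main_term n k) (a, b, c, d, e) =
    (2 + 3 * real n + 2 * real k + a) *
    (pochhammer (1 + b) (n + k) * pochhammer (1 + c) (n + k) * pochhammer (1 + d) (n + k) *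
     pochhammer (1 / 2 + e) (2 * n + k + 1) *
     (pochhammer (1 + (a - b - c)) n * pochhammer (1 + (a - b - d)) n * pochhammer (1 + (a - c - d)) n)) /
    (pochhammer (1 + (a - b)) (2 * n + k + 1) * pochhammer (1 + (a - c)) (2 * n + k + 1) *
     pochhammer (1 + (a - d)) (2 * n + k + 1) * pochhammer (1 / 2 + (a - e)) (n + k + 1) *
     pochhammer (1 / 2 + (2 * a - b - c - d - e)) n)"
  unfolding val_def prodval_def main_term_def fst_conv snd_conv list.map prod.case prod_list.Cons
    prod_list.Nil inner_forms
  by (simp only: pochhammer_1 mult_1_right mult_ac)

lemma val_carry:
  "val (carry_term n k) (a, b, c, d, e) =
    (3 + 3 * real n + real k + (2 * a - b - c - d)) *
    (pochhammer (1 + b) (n + k + 1) * pochhammer (1 + c) (n + k + 1) * pochhammer (1 + d) (n + k + 1) *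
     pochhammer (1 / 2 + e) (2 * n + k + 2) *
     (pochhammer (1 + (a - b - c)) n * pochhammer (1 + (a - b - d)) n * pochhammer (1 + (a - c - d)) n)) /
    (pochhammer (1 + (a - b)) (2 * n + k + 2) * pochhammer (1 + (a - c)) (2 * n + k + 2) *
     pochhammer (1 + (a - d)) (2 * n + k + 2) * pochhammer (1 / 2 + (a - e)) (n + k + 1) *
     pochhammer (1 / 2 + (2 * a - b - c - d - e)) (n + 1))"
  unfolding val_def prodval_def carry_term_def fst_conv snd_conv list.map prod.case prod_list.Cons
    prod_list.Nil inner_forms
  by (simp only: pochhammer_1 mult_1_right mult_ac)

text \<open>
  Summed over \<open>k\<close>, this says that the sums of the rows \<open>n\<close> and \<open>n + 1\<close> differ only by boundary terms
  in column 0, namely \<open>main_term n 0\<close> and \<open>carry_term n 0\<close>.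
\<close>
lemma wz_identity:
  assumes "regular (main_term n k) \<theta>"
  shows "val (main_term (Suc n) k) \<theta> - val (main_term n (Suc k)) \<theta> = val (carry_term n (Suc k)) \<theta> - val (carry_term n k) \<theta>"
proof -
  obtain a b c d e where \<theta>: "\<theta> = (a, b, c, d, e)" by (cases \<theta>) auto
  define x1 x2 x3 x4 x5 where "x1 = 1 + (a - b)" and "x2 = 1 + (a - c)" and "x3 = 1 + (a - d)"
    and "x4 = 1 / 2 + (a - e)" and "x5 = 1 / 2 + (2 * a - b - c - d - e)"
  note x_defs = x1_def x2_def x3_def x4_def x5_def
  have pos: "0 < x1" "0 < x2" "0 < x3" "0 < x4" "0 < x5"
    using assms by (auto simp: regular_def admissible_def main_term_def \<theta> x_defs algebra_simps)
  define A B C D E where "A = 2 + a + 3 * real n + 2 * real k" and "B = 1 + b + real n + real k"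
    and "C = 1 + c + real n + real k" and "D = 1 + d + real n + real k"
    and "E = 3 / 2 + e + 2 * real n + real k"
  note A_defs = A_def B_def C_def D_def E_def
  \<comment> \<open>The four terms are written over the common quotient \<open>N / (R * Y * X)\<close>, where \<open>Y\<close> and \<open>X\<close>
    collect the lower factors that appear when \<open>n\<close> or \<open>k\<close> grows by one.\<close>
  define N where "N = pochhammer (1 + b) (n + k + 1) * pochhammer (1 + c) (n + k + 1) *
     pochhammer (1 + d) (n + k + 1) * pochhammer (1 / 2 + e) (2 * n + k + 2) *
     (pochhammer (1 + (a - b - c)) n * pochhammer (1 + (a - b - d)) n * pochhammer (1 + (a - c - d)) n)"
  define R where "R = pochhammer x1 (2 * n + k + 2) * pochhammer x2 (2 * n + k + 2) *
     pochhammer x3 (2 * n + k + 2) * pochhammer x4 (n + k + 1) * pochhammer x5 n"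
  define X where "X = 1 + 2 * A - B - C - D - E"
  define Y where "Y = (2 + A - B) * (2 + A - C) * (2 + A - D) * (1 + A - E)"
  have facs: "x1 + real (2 * n + k + 2) = 2 + A - B" "x2 + real (2 * n + k + 2) = 2 + A - C"
    "x3 + real (2 * n + k + 2) = 2 + A - D" "x4 + real (n + k + 1) = 1 + A - E" "x5 + real n = X"
    by (simp_all add: x_defs A_defs X_def)
  have nz: "2 + A - B \<noteq> 0" "2 + A - C \<noteq> 0" "2 + A - D \<noteq> 0" "1 + A - E \<noteq> 0" "X \<noteq> 0"
    unfolding facs[symmetric] using pos by linarith+
  have Rnz: "R \<noteq> 0" unfolding R_def using pos by (simp add: pochhammer_pos less_imp_neq[THEN not_sym])
  have idx: "2 * Suc n + k + 1 = Suc (2 * n + k + 2)" "Suc n + k = n + k + 1"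
    "2 * n + Suc k + 1 = 2 * n + k + 2" "n + Suc k = n + k + 1"
    "2 * n + Suc k + 2 = Suc (2 * n + k + 2)" "n + 1 = Suc n" "n + k + 1 + 1 = Suc (n + k + 1)" by simp_all
  have uppers: "1 / 2 + e + real (2 * n + k + 2) = E + 1" "1 + (a - b - c) + real n = 1 + A - B - C"
      "1 + (a - b - d) + real n = 1 + A - B - D" "1 + (a - c - d) + real n = 1 + A - C - D"
      "1 + b + real (n + k + 1) = B + 1" "1 + c + real (n + k + 1) = C + 1" "1 + d + real (n + k + 1) = D + 1"
      "2 + 3 * real (Suc n) + 2 * real k + a = A + 3" "2 + 3 * real n + 2 * real (Suc k) + a = A + 2"
      "3 + 3 * real n + real k + (2 * a - b - c - d) = 2 + 2 * A - B - C - D"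
      "3 + 3 * real n + real (Suc k) + (2 * a - b - c - d) = 3 + 2 * A - B - C - D"
    by (simp_all add: A_defs)
  have F1: "val (main_term (Suc n) k) \<theta> = N / (R * Y * X) *
      ((A + 3) * (E + 1) * (1 + A - B - C) * (1 + A - B - D) * (1 + A - C - D))"
    unfolding \<theta> val_main idx uppers x_defs[symmetric] pochhammer_Suc facs
    by (simp add: N_def R_def Y_def mult_ac)
  have F2: "val (main_term n (Suc k)) \<theta> = N / (R * Y * X) *
      ((A + 2) * (2 + A - B) * (2 + A - C) * (2 + A - D) * X)"
    unfolding \<theta> val_main idx(2-7) uppers x_defs[symmetric] pochhammer_Suc facs
    using nz by (simp add: N_def R_def Y_def mult_ac)
  have M1: "val (carry_term n (Suc k)) \<theta> = N / (R * Y * X) *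
      ((B + 1) * (C + 1) * (D + 1) * (E + 1) * (3 + 2 * A - B - C - D))"
    unfolding \<theta> val_carry idx uppers x_defs[symmetric] pochhammer_Suc facs
    by (simp add: N_def R_def Y_def mult_ac)
  have M2: "val (carry_term n k) \<theta> = N / (R * Y * X) *
      ((2 + 2 * A - B - C - D) * (2 + A - B) * (2 + A - C) * (2 + A - D) * (1 + A - E))"
    unfolding \<theta> val_carry idx(6) uppers x_defs[symmetric] pochhammer_Suc facs
    using nz by (simp add: N_def R_def Y_def mult_ac)
  show ?thesis
    unfolding F1 F2 M1 M2 right_diff_distrib[symmetric] X_def
    by (simp only: certificate_identity)
qed

lemma regular_at_0: "regular (main_term n k) 0" "regular (carry_term n k) 0"
  by (auto simp: regular_def admissible_def main_term_def carry_term_def)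

lemma wz_identity_deriv1_regular:
  assumes reg: "regular (main_term (Suc n) k) \<theta>" "regular (main_term n (Suc k)) \<theta>"
      "regular (carry_term n (Suc k)) \<theta>" "regular (carry_term n k) \<theta>" "regular (main_term n k) \<theta>"
  shows "deriv1 (main_term (Suc n) k) \<theta> p - deriv1 (main_term n (Suc k)) \<theta> p = deriv1 (carry_term n (Suc k)) \<theta> p - deriv1 (carry_term n k) \<theta> p"
proof (rule derivative_relation[where f = val and \<theta> = \<theta> and q = p])
  show "((\<lambda>s. val X (\<theta> + s *\<^sub>R p)) has_real_derivative deriv1 X \<theta> p) (at 0)"
    if "X \<in> {main_term (Suc n) k, main_term n (Suc k), carry_term n (Suc k), carry_term n k}" for X
    unfolding deriv1_def by (rule val_has_derivative) (use that reg in auto)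
  show "\<forall>\<^sub>F s in nhds 0. val (main_term (Suc n) k) (\<theta> + s *\<^sub>R p) - val (main_term n (Suc k)) (\<theta> + s *\<^sub>R p)
      = val (carry_term n (Suc k)) (\<theta> + s *\<^sub>R p) - val (carry_term n k) (\<theta> + s *\<^sub>R p)"
    using eventually_regular[OF reg(5), of p] by eventually_elim (rule wz_identity)
qed

lemma wz_identity_deriv1:
  "deriv1 (main_term (Suc n) k) 0 p - deriv1 (main_term n (Suc k)) 0 p = deriv1 (carry_term n (Suc k)) 0 p - deriv1 (carry_term n k) 0 p"
  by (intro wz_identity_deriv1_regular regular_at_0)

lemma wz_identity_deriv2:
  "deriv2 (main_term (Suc n) k) 0 p q - deriv2 (main_term n (Suc k)) 0 p q = deriv2 (carry_term n (Suc k)) 0 p q - deriv2 (carry_term n k) 0 p q"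
proof (rule derivative_relation[where f = "\<lambda>X \<theta>. deriv1 X \<theta> p" and \<theta> = 0 and q = q])
  show "((\<lambda>s. deriv1 X (0 + s *\<^sub>R q) p) has_real_derivative deriv2 X 0 p q) (at 0)"
    if "X \<in> {main_term (Suc n) k, main_term n (Suc k), carry_term n (Suc k), carry_term n k}" for X
    by (rule deriv1_has_derivative) (use that regular_at_0 in auto)
  show "\<forall>\<^sub>F s in nhds 0. deriv1 (main_term (Suc n) k) (0 + s *\<^sub>R q) p - deriv1 (main_term n (Suc k)) (0 + s *\<^sub>R q) p
      = deriv1 (carry_term n (Suc k)) (0 + s *\<^sub>R q) p - deriv1 (carry_term n k) (0 + s *\<^sub>R q) p"
    using eventually_regular[OF regular_at_0(1)[of "Suc n" k], of q]
      eventually_regular[OF regular_at_0(1)[of n "Suc k"], of q]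
      eventually_regular[OF regular_at_0(2)[of n "Suc k"], of q]
      eventually_regular[OF regular_at_0(2)[of n k], of q]
      eventually_regular[OF regular_at_0(1)[of n k], of q]
    by eventually_elim (rule wz_identity_deriv1_regular)
qed

section \<open>Summing the telescoping relation\<close>

text \<open>
  The relation makes \<open>f (n+1) k - f n k\<close> the difference in \<open>k\<close> of \<open>f n k + m n k\<close>, so each step from
  row \<open>n\<close> to row \<open>n + 1\<close> lowers the row sum by \<open>f n 0 + m n 0\<close>. Since the row sums tend to 0
  geometrically, the column collects the whole sum of row 0.
\<close>
lemma wz_sum:
  fixes f m :: "nat \<Rightarrow> nat \<Rightarrow> real"
  assumes wz: "\<And>n k. f (Suc n) k - f n (Suc k) = m n (Suc k) - m n k"
    and bound: "\<And>n k. \<bar>f n k\<bar> \<le> C * r ^ n * u k"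
    and u: "summable u" and r: "0 \<le> r" "r < 1"
    and m: "\<And>n. m n \<longlonglongrightarrow> 0"
    and S: "f 0 sums S"
  shows "(\<lambda>n. f n 0 + m n 0) sums S"
proof -
  have summ: "summable (f n)" for n
    by (rule summable_comparison_test'[OF summable_mult[OF u, of "C * r ^ n"]]) (use bound in auto)
  have step: "suminf (f (Suc n)) - suminf (f n) = - (f n 0 + m n 0)" for n
  proof -
    have "(\<Sum>k<K. f (Suc n) k - f n k) = (f n K + m n K) - (f n 0 + m n 0)" for K
      using wz by (induction K) (simp_all add: algebra_simps)
    moreover have "(\<lambda>K. (f n K + m n K) - (f n 0 + m n 0)) \<longlonglongrightarrow> (0 + 0) - (f n 0 + m n 0)"
      by (intro tendsto_intros m summable_LIMSEQ_zero summ)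
    ultimately have "(\<lambda>k. f (Suc n) k - f n k) sums - (f n 0 + m n 0)"
      by (simp add: sums_def)
    moreover have "(\<lambda>k. f (Suc n) k - f n k) sums (suminf (f (Suc n)) - suminf (f n))"
      by (intro sums_diff summable_sums summ)
    ultimately show ?thesis by (rule sums_unique2[symmetric])
  qed
  have partial: "(\<Sum>n<N. f n 0 + m n 0) = suminf (f 0) - suminf (f N)" for N
  proof (induction N)
    case (Suc N)
    then show ?case using step[of N] by simp
  qed simp
  have "(\<lambda>N. suminf (f N)) \<longlonglongrightarrow> 0"
  proof (rule Lim_null_comparison)
    show "\<forall>\<^sub>F N in sequentially. norm (suminf (f N)) \<le> C * r ^ N * suminf u"
    proof (rule always_eventually, rule allI)
      fix N
      have s: "summable (\<lambda>k. \<bar>f N k\<bar>)"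
        by (rule summable_comparison_test'[OF summable_mult[OF u, of "C * r ^ N"]]) (use bound in auto)
      have "\<bar>suminf (f N)\<bar> \<le> (\<Sum>k. \<bar>f N k\<bar>)" by (rule summable_rabs[OF s])
      also have "\<dots> \<le> (\<Sum>k. C * r ^ N * u k)"
        by (rule suminf_le[OF bound s summable_mult[OF u]])
      also have "\<dots> = C * r ^ N * suminf u" by (rule suminf_mult[OF u])
      finally show "norm (suminf (f N)) \<le> C * r ^ N * suminf u" by simp
    qed
    have "(\<lambda>N. C * r ^ N * suminf u) \<longlonglongrightarrow> C * 0 * suminf u"
      by (intro tendsto_intros LIMSEQ_realpow_zero r)
    then show "(\<lambda>N. C * r ^ N * suminf u) \<longlonglongrightarrow> 0" by simp
  qed
  then have "(\<lambda>N. suminf (f 0) - suminf (f N)) \<longlonglongrightarrow> suminf (f 0) - 0"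
    by (intro tendsto_intros)
  moreover have "suminf (f 0) = S" using S by (rule sums_unique[symmetric])
  ultimately show ?thesis by (simp add: sums_def partial)
qed

section \<open>Estimates\<close>

text \<open>
  A second derivative of a quotient costs a factor of the size of a squared harmonic number. The only
  thing that matters is that the square root here is small against the decay of \<open>val_main_0_le\<close> and
  \<open>val_carry_0_le\<close> in \<open>k\<close>.
\<close>
lemma harm_squared_le: "harm m ^ 2 \<le> 36 * sqrt (real m)"
proof (cases "m = 0")
  case True
  then show ?thesis by (simp add: harm_def)
next
  case False
  then have m: "0 < m" "1 \<le> real m" by auto
  \<comment> \<open>The exponent \<open>1 / 4\<close> becomes a square root after squaring.\<close>
  have "harm m \<le> ln (real m) + 1"
    using euler_mascheroni_sequence_decreasing[of 1 m] m by (simp add: harm_expand)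
  also have "ln (real m) \<le> real m powr (1 / 4) / (1 / 4)"
    by (rule ln_powr_bound) (use m in auto)
  finally have "harm m \<le> 4 * real m powr (1 / 4) + 1" by simp
  also have "\<dots> \<le> 6 * real m powr (1 / 4)"
    using ge_one_powr_ge_zero[of "real m" "1 / 4"] m by simp
  finally have "(harm m :: real) ^ 2 \<le> (6 * real m powr (1 / 4)) ^ 2"
    by (intro power_mono harm_nonneg)
  also have "\<dots> = 36 * sqrt (real m)"
    using m by (simp add: power_mult_distrib powr_half_sqrt[symmetric] powr_power)
  finally show ?thesis .
qed

lemma harm_ge_1: "0 < m \<Longrightarrow> (1 :: real) \<le> harm m"
  using harm_mono[of 1 m] by (simp add: harm_expand)

lemma recip_sum_1_bounds:
  assumes "1 / 2 \<le> c" "m \<le> N"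
  shows "0 \<le> recip_sum 1 m c" "recip_sum 1 m c \<le> 2 * harm N"
proof -
  show "0 \<le> recip_sum 1 m c" unfolding recip_sum_def using assms by (intro sum_nonneg) simp
  have "recip_sum 1 m c \<le> (\<Sum>j<m. 2 * (1 / real (Suc j)))"
    unfolding recip_sum_def using assms by (intro sum_mono) (simp add: field_simps)
  also have "\<dots> = 2 * harm m"
    by (simp add: harm_def sum_distrib_left inverse_eq_divide sum.atLeast1_atMost_eq)
  also have "\<dots> \<le> 2 * harm N" using assms(2) by (simp add: harm_mono)
  finally show "recip_sum 1 m c \<le> 2 * harm N" .
qed

lemma recip_sum_2_bounds:
  assumes "1 / 2 \<le> c" "m \<le> N"
  shows "0 \<le> recip_sum 2 m c" "recip_sum 2 m c \<le> 4 * harm N"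
proof -
  show "0 \<le> recip_sum 2 m c" unfolding recip_sum_def using assms by (intro sum_nonneg) simp
  have "recip_sum 2 m c \<le> (\<Sum>j<m. 2 * (1 / (c + real j) ^ 1))"
    unfolding recip_sum_def
  proof (rule sum_mono)
    fix j
    have "0 < c + real j" "1 / (c + real j) \<le> 2" using assms by (auto simp: field_simps)
    then have "1 / (c + real j) * (1 / (c + real j)) \<le> 2 * (1 / (c + real j))"
      by (intro mult_right_mono) auto
    then show "1 / (c + real j) ^ 2 \<le> 2 * (1 / (c + real j) ^ 1)" by (simp add: power2_eq_square)
  qed
  also have "\<dots> = 2 * recip_sum 1 m c" by (simp add: recip_sum_def sum_distrib_left)
  finally show "recip_sum 2 m c \<le> 4 * harm N" using recip_sum_1_bounds[OF assms] by simp
qed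

lemma dlogs_bound:
  assumes "\<forall>(c, l, m)\<in>set xs. 1 / 2 \<le> c \<and> m \<le> N"
  shows "\<bar>dlogs xs 0 p\<bar> \<le> (\<Sum>(c, l, m)\<leftarrow>xs. \<bar>l \<bullet> p\<bar>) * (2 * harm N)"
  using assms
proof (induction xs)
  case (Cons x xs)
  obtain c l m where x: "x = (c, l, m)" by (cases x) auto
  have "\<bar>(l \<bullet> p) * recip_sum 1 m c\<bar> \<le> \<bar>l \<bullet> p\<bar> * (2 * harm N)"
    unfolding abs_mult using recip_sum_1_bounds[of c m N] Cons.prems
    by (intro mult_left_mono) (auto simp: x)
  then show ?case using Cons by (simp add: dlogs_def x algebra_simps)
qed (simp add: dlogs_def)

lemma ddlogs_bound:
  assumes "\<forall>(c, l, m)\<in>set xs. 1 / 2 \<le> c \<and> m \<le> N"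
  shows "\<bar>ddlogs xs 0 p q\<bar> \<le> (\<Sum>(c, l, m)\<leftarrow>xs. \<bar>(l \<bullet> p) * (l \<bullet> q)\<bar>) * (4 * harm N)"
  using assms
proof (induction xs)
  case (Cons x xs)
  obtain c l m where x: "x = (c, l, m)" by (cases x) auto
  have "\<bar>(l \<bullet> p) * (l \<bullet> q) * recip_sum 2 m c\<bar> \<le> \<bar>(l \<bullet> p) * (l \<bullet> q)\<bar> * (4 * harm N)"
    unfolding abs_mult[of _ "recip_sum 2 m c"] using recip_sum_2_bounds[of c m N] Cons.prems
    by (intro mult_left_mono) (auto simp: x)
  then show ?case using Cons by (simp add: ddlogs_def x algebra_simps)
qed (simp add: ddlogs_def)

text \<open>
  The constants in the estimates of the derivatives. They involve only the linear forms, not the lengths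
  of the shifted factorials, and so are the same for all \<open>n\<close> and \<open>k\<close> (\<open>weight_independent\<close>).
\<close>
definition weight1 :: "params \<Rightarrow> quot \<Rightarrow> real" where
  "weight1 p X = (\<Sum>(c, l, m)\<leftarrow>fst X @ snd X. \<bar>l \<bullet> p\<bar>)"
definition weight2 :: "params \<Rightarrow> params \<Rightarrow> quot \<Rightarrow> real" where
  "weight2 p q X = (\<Sum>(c, l, m)\<leftarrow>fst X @ snd X. \<bar>(l \<bullet> p) * (l \<bullet> q)\<bar>)"

lemma weight_nonneg: "0 \<le> weight1 p X" "0 \<le> weight2 p q X"
  unfolding weight1_def weight2_def by (rule sum_list_nonneg, force)+

lemma derivative_bounds:
  assumes X: "\<forall>(c, l, m)\<in>set (fst X) \<union> set (snd X). 1 / 2 \<le> c \<and> m \<le> N" and N: "0 < N"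
  shows "\<bar>deriv1 X 0 p\<bar> \<le> 2 * weight1 p X * (val X 0 * harm N ^ 2)"
    and "\<bar>deriv2 X 0 p q\<bar> \<le> (4 * weight1 p X * weight1 q X + 4 * weight2 p q X) * (val X 0 * harm N ^ 2)"
proof -
  define h :: real where "h = harm N"
  have h: "1 \<le> h" "h \<le> h ^ 2" using harm_ge_1[OF N] power_increasing[of 1 2 "harm N :: real"] by (auto simp: h_def)
  have "0 < fst x" if "x \<in> set (fst X) \<union> set (snd X)" for x
    using bspec[OF X that] by (simp add: case_prod_beta)
  then have "regular X 0" by (simp add: regular_def admissible_def case_prod_beta)
  then have v: "0 \<le> val X 0"
    using prodval_pos[of "fst X" 0] prodval_pos[of "snd X" 0] by (simp add: val_def regular_def)
  have L: "\<bar>dlog X 0 p\<bar> \<le> weight1 p X * (2 * h)" for p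
    using dlogs_bound[of "fst X" N p] dlogs_bound[of "snd X" N p] X
    by (simp add: dlog_def weight1_def h_def algebra_simps)
  have LL: "\<bar>ddlog X 0 p q\<bar> \<le> weight2 p q X * (4 * h)"
    using ddlogs_bound[of "fst X" N p q] ddlogs_bound[of "snd X" N p q] X
    by (simp add: ddlog_def weight2_def h_def algebra_simps)
  have "\<bar>dlog X 0 p\<bar> \<le> 2 * weight1 p X * h ^ 2"
    using L[of p] mult_left_mono[OF h(2), of "2 * weight1 p X"] weight_nonneg(1)[of p X] by simp
  from mult_left_mono[OF this v] show "\<bar>deriv1 X 0 p\<bar> \<le> 2 * weight1 p X * (val X 0 * harm N ^ 2)"
    using v by (simp add: deriv1_def abs_mult h_def algebra_simps)
  have "\<bar>dlog X 0 p * dlog X 0 q\<bar> \<le> (weight1 p X * (2 * h)) * (weight1 q X * (2 * h))"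
    unfolding abs_mult by (intro mult_mono L) (use h weight_nonneg in auto)
  moreover have "weight2 p q X * (4 * h) \<le> weight2 p q X * (4 * h ^ 2)"
    using h weight_nonneg by (intro mult_left_mono) auto
  ultimately have "\<bar>dlog X 0 p * dlog X 0 q + ddlog X 0 p q\<bar>
      \<le> (4 * weight1 p X * weight1 q X + 4 * weight2 p q X) * h ^ 2"
    using LL by (simp add: algebra_simps power2_eq_square)
  from mult_left_mono[OF this v]
  show "\<bar>deriv2 X 0 p q\<bar> \<le> (4 * weight1 p X * weight1 q X + 4 * weight2 p q X) * (val X 0 * harm N ^ 2)"
    using v by (simp add: deriv2_def abs_mult h_def mult_ac)
qed

lemma term_entries:
  "\<forall>(c, l, m)\<in>set (fst (main_term n k)) \<union> set (snd (main_term n k)). 1 / 2 \<le> c \<and> m \<le> 2 * n + k + 2"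
  "\<forall>(c, l, m)\<in>set (fst (carry_term n k)) \<union> set (snd (carry_term n k)). 1 / 2 \<le> c \<and> m \<le> 2 * n + k + 2"
  by (auto simp: main_term_def carry_term_def)

lemma weight_independent:
  "weight1 p (main_term n k) = weight1 p (main_term 0 0)" "weight1 p (carry_term n k) = weight1 p (carry_term 0 0)"
  "weight2 p q (main_term n k) = weight2 p q (main_term 0 0)" "weight2 p q (carry_term n k) = weight2 p q (carry_term 0 0)"
  by (simp_all add: weight1_def weight2_def main_term_def carry_term_def)

lemma val_main_0: "val (main_term n k) 0 = (2 + 3 * real n + 2 * real k) *
    (fact (n + k) ^ 3 * pochhammer (1 / 2) (2 * n + k + 1) * fact n ^ 3) /
    (fact (2 * n + k + 1) ^ 3 * pochhammer (1 / 2) (n + k + 1) * pochhammer (1 / 2) n)"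
  unfolding zero_prod_def val_main
  by (simp add: pochhammer_fact power3_eq_cube mult_ac)

lemma val_carry_0: "val (carry_term n k) 0 = (3 + 3 * real n + real k) *
    (fact (n + k + 1) ^ 3 * pochhammer (1 / 2) (2 * n + k + 2) * fact n ^ 3) /
    (fact (2 * n + k + 2) ^ 3 * pochhammer (1 / 2) (n + k + 1) * pochhammer (1 / 2) (n + 1))"
  unfolding zero_prod_def val_carry
  by (simp add: pochhammer_fact power3_eq_cube mult_ac)

lemma pochhammer_half_pos: "0 < pochhammer (1 / 2 :: real) m"
  by (simp add: pochhammer_pos)

text \<open>
  \<open>(1/2)\<^sub>m / m!\<close> decreases in \<open>m\<close>, so for \<open>i \<le> j\<close> the quotient of \<open>(1/2)\<^sub>j\<close> by \<open>(1/2)\<^sub>i\<close> is at most \<open>j! / i!\<close>.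
\<close>
lemma pochhammer_half_ratio:
  assumes "i \<le> j"
  shows "pochhammer (1 / 2 :: real) j / fact j \<le> pochhammer (1 / 2) i / fact i"
  using assms
proof (induction rule: dec_induct)
  case (step j)
  have "pochhammer (1 / 2 :: real) (Suc j) / fact (Suc j)
      = pochhammer (1 / 2) j / fact j * ((1 / 2 + real j) / (1 + real j))"
    by (simp add: pochhammer_Suc)
  also have "\<dots> \<le> pochhammer (1 / 2) j / fact j * 1"
    by (intro mult_left_mono) (auto simp: less_imp_le[OF pochhammer_half_pos])
  finally show ?case using step by simp
qed simp

lemma fact_over_pochhammer_half: "fact n / pochhammer (1 / 2 :: real) n \<le> 2 * real n + 1"
proof (induction n)
  case (Suc n)
  have "fact (Suc n) / pochhammer (1 / 2 :: real) (Suc n)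
      = fact n / pochhammer (1 / 2) n * ((1 + real n) / (1 / 2 + real n))"
    by (simp add: pochhammer_Suc)
  also have "\<dots> \<le> (2 * real n + 1) * ((1 + real n) / (1 / 2 + real n))"
    by (intro mult_right_mono Suc) auto
  also have "\<dots> \<le> 2 * real (Suc n) + 1" by (simp add: field_simps)
  finally show ?case .
qed simp

text \<open>
  The quotient is a Beta value; raising \<open>n\<close> by one multiplies it by less than \<open>s (s + k) / (2 s + k)\<^sup>2\<close> with
  \<open>s = n + 1\<close>, which is at most \<open>1 / 4\<close> by the inequality of the means. Its square is the source of the
  geometric convergence in \<open>n\<close>.
\<close>
lemma beta_bound: "fact (n + k) * fact n / fact (2 * n + k + 1) \<le> (1 / 4 :: real) ^ n / (real k + 1)"
proof (induction n)
  case 0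
  then show ?case by (simp add: field_simps)
next
  case (Suc n)
  have "fact (Suc n + k) * fact (Suc n) / (fact (2 * Suc n + k + 1) :: real)
     = fact (n + k) * fact n / fact (2 * n + k + 1) *
        ((real n + real k + 1) * (real n + 1) / ((2 * real n + real k + 2) * (2 * real n + real k + 3)))"
    by (simp add: divide_simps) (simp add: algebra_simps)
  also have "\<dots> \<le> (1 / 4) ^ n / (real k + 1) * (1 / 4)"
  proof (intro mult_mono Suc)
    have "4 * ((real n + real k + 1) * (real n + 1)) \<le> (2 * real n + real k + 2) * (2 * real n + real k + 3)"
      by (simp add: algebra_simps)
    then show "(real n + real k + 1) * (real n + 1) /
        ((2 * real n + real k + 2) * (2 * real n + real k + 3)) \<le> 1 / 4"
      by (simp only: divide_le_eq times_divide_eq_left) simp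
  qed auto
  also have "\<dots> = (1 / 4) ^ Suc n / (real k + 1)" by simp
  finally show ?case .
qed

lemma val_main_0_le: "val (main_term n k) 0 \<le> 3 * (2 * real n + 1) * (1 / 16) ^ n / (real k + 1) ^ 2"
proof -
  define P where "P = (pochhammer (1 / 2) :: nat \<Rightarrow> real)"
  have P: "0 < P m" for m unfolding P_def by (rule pochhammer_half_pos)
  define \<beta> :: real where "\<beta> = fact (n + k) * fact n / fact (2 * n + k + 1)"
  have b: "0 \<le> \<beta>" by (simp add: \<beta>_def)
  have "P (2 * n + k + 1) * fact (n + k + 1) / (P (n + k + 1) * fact (2 * n + k + 1)) \<le> 1"
    using pochhammer_half_ratio[of "n + k + 1" "2 * n + k + 1"] P[of "n + k + 1"]
    by (simp add: P_def divide_simps mult_ac)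
  have "val (main_term n k) 0 = \<beta> ^ 2 * (fact n / P n) * ((2 + 3 * real n + 2 * real k) / (real n + real k + 1)) *
      (P (2 * n + k + 1) * fact (n + k + 1) / (P (n + k + 1) * fact (2 * n + k + 1)))"
    unfolding val_main_0 P_def[symmetric] \<beta>_def
    by (simp add: divide_simps power2_eq_square power3_eq_cube)
  also have "\<dots> \<le> \<beta> ^ 2 * (2 * real n + 1) * 3 * 1"
  proof (intro mult_mono order_refl)
    show "fact n / P n \<le> 2 * real n + 1" unfolding P_def by (rule fact_over_pochhammer_half)
    show "(2 + 3 * real n + 2 * real k) / (real n + real k + 1) \<le> 3" by (simp add: field_simps)
  qed (use P b \<open>_ \<le> 1\<close> in \<open>auto intro: mult_nonneg_nonneg less_imp_le\<close>)
  also have "\<dots> \<le> ((1 / 4) ^ n / (real k + 1)) ^ 2 * (2 * real n + 1) * 3 * 1"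
    using beta_bound[of n k] b unfolding \<beta>_def
    by (intro mult_right_mono power_mono) auto
  also have "\<dots> = 3 * (2 * real n + 1) * (1 / 16) ^ n / (real k + 1) ^ 2"
    by (simp add: power_divide power_mult[symmetric] power2_eq_square power_mult_distrib[symmetric])
  finally show ?thesis .
qed

lemma val_carry_0_le:
  obtains C where "\<And>k. val (carry_term n k) 0 \<le> C / (real k + 1)"
proof -
  define P where "P = (pochhammer (1 / 2) :: nat \<Rightarrow> real)"
  have P: "0 < P m" for m unfolding P_def by (rule pochhammer_half_pos)
  have "val (carry_term n k) 0 \<le> 3 * (fact n ^ 3 / P (n + 1)) / (real k + 1)" for k
  proof -
    define \<phi> :: real where "\<phi> = fact (n + k + 1) / fact (2 * n + k + 2)"
    define x where "x = 2 * real n + real k + 2"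
    have x: "0 < x" by (simp add: x_def)
    have "fact (n + k + 1) \<le> (fact (2 * n + k + 1) :: real)" by (rule fact_mono) simp
    moreover have "fact (2 * n + k + 2) = x * (fact (2 * n + k + 1) :: real)"
      by (simp add: x_def)
    ultimately have phi: "0 \<le> \<phi>" "\<phi> \<le> 1 / x"
      using x by (auto simp: \<phi>_def divide_simps simp del: fact_Suc)
    have r: "P (2 * n + k + 2) * fact (n + k + 1) / (P (n + k + 1) * fact (2 * n + k + 2)) \<le> 1"
      using pochhammer_half_ratio[of "n + k + 1" "2 * n + k + 2"] P[of "n + k + 1"]
      by (simp add: P_def divide_simps mult_ac)
    have "val (carry_term n k) 0 = (fact n ^ 3 / P (n + 1)) * ((3 + 3 * real n + real k) * \<phi> ^ 2) *
        (P (2 * n + k + 2) * fact (n + k + 1) / (P (n + k + 1) * fact (2 * n + k + 2)))"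
      unfolding val_carry_0 P_def[symmetric] \<phi>_def
      by (simp add: divide_simps power2_eq_square power3_eq_cube del: fact_Suc) 
    also have "\<dots> \<le> (fact n ^ 3 / P (n + 1)) * ((3 * x) * (1 / x) ^ 2) * 1"
      using phi r x P[of "n + 1"] P[of "n + k + 1"] P[of "2 * n + k + 2"]
      by (intro mult_mono power_mono order_refl) (auto simp: x_def intro!: mult_nonneg_nonneg less_imp_le)
    also have "\<dots> = (fact n ^ 3 / P (n + 1)) * (3 * (1 / x))"
      using x by (simp add: power2_eq_square)
    also have "\<dots> \<le> (fact n ^ 3 / P (n + 1)) * (3 * (1 / (real k + 1)))"
      using P[of "n + 1"] by (intro mult_left_mono) (auto simp: x_def field_simps)
    finally show ?thesis by (simp add: mult_ac)
  qed
  then show ?thesis by (rule that)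
qed

lemma summable_sqrt_tail: "summable (\<lambda>k. 1 / (real k + 1) powr (3 / 2))"
proof -
  have "summable (\<lambda>k. real (Suc k) powr (- (3 / 2)))"
    using summable_real_powr_iff[of "- (3 / 2)"] by (subst summable_Suc_iff) auto
  then show ?thesis by (simp add: powr_minus_divide add.commute)
qed

text \<open>
  Separating the variables lets the geometric decay in \<open>n\<close> absorb one factor and the decay in \<open>k\<close> the
  other.
\<close>
lemma harm_squared_le_split: "harm (2 * n + k + 2) ^ 2 \<le> 36 * (2 * (real n + 1)) * sqrt (real k + 1)"
proof -
  have "harm (2 * n + k + 2) ^ 2 \<le> 36 * sqrt (real (2 * n + k + 2))" by (rule harm_squared_le)
  also have "\<dots> \<le> 36 * sqrt ((2 * (real n + 1)) ^ 2 * (real k + 1))"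
    by (intro mult_left_mono real_sqrt_le_mono) (simp_all add: power2_eq_square algebra_simps)
  also have "\<dots> = 36 * (2 * (real n + 1)) * sqrt (real k + 1)"
    by (simp add: real_sqrt_mult)
  finally show ?thesis .
qed

lemma sqrt_over_square: "sqrt (real k + 1) / (real k + 1) ^ 2 = 1 / (real k + 1) powr (3 / 2)"
proof -
  have "(real k + 1) ^ 2 = (real k + 1) powr (1 / 2) * (real k + 1) powr (3 / 2)"
    by (simp add: powr_add[symmetric])
  then show ?thesis by (simp add: powr_half_sqrt[symmetric])
qed

lemma val_main_harm_bound:
  "val (main_term n k) 0 * harm (2 * n + k + 2) ^ 2 \<le> 432 * (1 / 4) ^ n * (1 / (real k + 1) powr (3 / 2))"
proof -
  have p: "(2 * real n + 1) * (real n + 1) \<le> 2 * 4 ^ n"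
  proof -
    have "1 + real n \<le> 2 ^ n" using Bernoulli_inequality[of 1 n] by simp
    then have "(1 + real n) * (1 + real n) \<le> 2 ^ n * 2 ^ n" by (intro mult_mono) auto
    also have "\<dots> = 4 ^ n" by (simp add: power_mult_distrib[symmetric])
    finally show ?thesis by (simp add: algebra_simps)
  qed
  have "val (main_term n k) 0 * harm (2 * n + k + 2) ^ 2
     \<le> (3 * (2 * real n + 1) * (1 / 16) ^ n / (real k + 1) ^ 2) * (36 * (2 * (real n + 1)) * sqrt (real k + 1))"
    by (intro mult_mono val_main_0_le harm_squared_le_split) auto
  also have "\<dots> = 216 * ((2 * real n + 1) * (real n + 1)) * (1 / 16) ^ n * (sqrt (real k + 1) / (real k + 1) ^ 2)"
    by (simp add: field_simps)
  also have "\<dots> \<le> 216 * (2 * 4 ^ n) * (1 / 16) ^ n * (sqrt (real k + 1) / (real k + 1) ^ 2)"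
    by (intro mult_right_mono mult_left_mono p) auto
  also have "\<dots> = 432 * (1 / 4) ^ n * (1 / (real k + 1) powr (3 / 2))"
    unfolding sqrt_over_square by (simp add: power_mult_distrib[symmetric])
  finally show ?thesis .
qed

lemma val_carry_harm_tendsto:
  "(\<lambda>k. val (carry_term n k) 0 * harm (2 * n + k + 2) ^ 2) \<longlonglongrightarrow> 0"
proof -
  obtain C where C: "\<And>k. val (carry_term n k) 0 \<le> C / (real k + 1)" by (rule val_carry_0_le) blast
  have v: "0 < val (carry_term n k) 0" for k
    using prodval_pos[of "fst (carry_term n k)" 0] prodval_pos[of "snd (carry_term n k)" 0] regular_at_0(2)[of n k]
    by (simp add: val_def regular_def)
  have "0 < C" using less_le_trans[OF v[of 0] C[of 0]] by simp
  have b: "norm (val (carry_term n k) 0 * harm (2 * n + k + 2) ^ 2)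
      \<le> (C * (36 * (2 * (real n + 1)))) * (1 / sqrt (real k + 1))" for k
  proof -
    have "val (carry_term n k) 0 * harm (2 * n + k + 2) ^ 2
        \<le> C / (real k + 1) * (36 * (2 * (real n + 1)) * sqrt (real k + 1))"
      by (intro mult_mono C harm_squared_le_split) (use \<open>0 < C\<close> in auto)
    also have "\<dots> = (C * (36 * (2 * (real n + 1)))) * (sqrt (real k + 1) / (real k + 1))"
      by simp
    also have "sqrt (real k + 1) / (real k + 1) = 1 / sqrt (real k + 1)"
      by (rule sqrt_divide_self_eq[THEN trans]) (auto simp: inverse_eq_divide)
    finally show ?thesis using v[of k] by simp
  qed
  have "(\<lambda>k. (C * (36 * (2 * (real n + 1)))) * (1 / sqrt (real k + 1))) \<longlonglongrightarrow> (C * (36 * (2 * (real n + 1)))) * 0"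
    by (intro tendsto_intros) real_asymp
  then show ?thesis
    by (intro Lim_null_comparison[OF always_eventually[rule_format, OF b]]) simp
qed

text \<open>
  \<open>D\<close> will be a first or a mixed second directional derivative at 0. Only the finite relation
  \<open>wz\<close> has been differentiated, so nothing has to be uniform in the parameters: it is enough that the
  differentiated terms are still small.
\<close>
lemma derivative_sum_transfer:
  fixes D :: "quot \<Rightarrow> real"
  assumes wz: "\<And>n k. D (main_term (Suc n) k) - D (main_term n (Suc k)) = D (carry_term n (Suc k)) - D (carry_term n k)"
    and F: "\<And>n k. \<bar>D (main_term n k)\<bar> \<le> C * (val (main_term n k) 0 * harm (2 * n + k + 2) ^ 2)"
    and M: "\<And>n k. \<bar>D (carry_term n k)\<bar> \<le> C' * (val (carry_term n k) 0 * harm (2 * n + k + 2) ^ 2)"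
    and C: "0 \<le> C"
    and S: "(\<lambda>k. D (main_term 0 k)) sums S"
  shows "(\<lambda>n. D (main_term n 0) + D (carry_term n 0)) sums S"
proof (rule wz_sum[where f = "\<lambda>n k. D (main_term n k)" and m = "\<lambda>n k. D (carry_term n k)"
      and C = "C * 432" and r = "1 / 4" and u = "\<lambda>k. 1 / (real k + 1) powr (3 / 2)"])
  show "\<bar>D (main_term n k)\<bar> \<le> C * 432 * (1 / 4) ^ n * (1 / (real k + 1) powr (3 / 2))" for n k
    using order_trans[OF F mult_left_mono[OF val_main_harm_bound C]] by (simp add: mult.assoc)
  show "(\<lambda>k. D (carry_term n k)) \<longlonglongrightarrow> 0" for n
    by (rule Lim_null_comparison[OF always_eventually tendsto_mult_right_zero[OF val_carry_harm_tendsto]])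
       (use M in auto)
qed (use wz S summable_sqrt_tail in auto)

lemma first_order_transfer:
  assumes "(\<lambda>k. deriv1 (main_term 0 k) 0 p) sums S"
  shows "(\<lambda>n. deriv1 (main_term n 0) 0 p + deriv1 (carry_term n 0) 0 p) sums S"
proof (rule derivative_sum_transfer[where D = "\<lambda>X. deriv1 X 0 p" and C = "2 * weight1 p (main_term 0 0)"
      and C' = "2 * weight1 p (carry_term 0 0)"])
  show "\<bar>deriv1 (main_term n k) 0 p\<bar> \<le> 2 * weight1 p (main_term 0 0) * (val (main_term n k) 0 * harm (2 * n + k + 2) ^ 2)" for n k
    using derivative_bounds(1)[OF term_entries(1)[of n k], of p] unfolding weight_independent(1)[of p n k] by simp
  show "\<bar>deriv1 (carry_term n k) 0 p\<bar> \<le> 2 * weight1 p (carry_term 0 0) * (val (carry_term n k) 0 * harm (2 * n + k + 2) ^ 2)" for n k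
    using derivative_bounds(1)[OF term_entries(2)[of n k], of p] unfolding weight_independent(2)[of p n k] by simp
qed (use assms weight_nonneg wz_identity_deriv1 in auto)

lemma second_order_transfer:
  assumes "(\<lambda>k. deriv2 (main_term 0 k) 0 p q) sums S"
  shows "(\<lambda>n. deriv2 (main_term n 0) 0 p q + deriv2 (carry_term n 0) 0 p q) sums S"
proof (rule derivative_sum_transfer[where D = "\<lambda>X. deriv2 X 0 p q"
      and C = "4 * weight1 p (main_term 0 0) * weight1 q (main_term 0 0) + 4 * weight2 p q (main_term 0 0)"
      and C' = "4 * weight1 p (carry_term 0 0) * weight1 q (carry_term 0 0) + 4 * weight2 p q (carry_term 0 0)"])
  show "\<bar>deriv2 (main_term n k) 0 p q\<bar> \<le> (4 * weight1 p (main_term 0 0) * weight1 q (main_term 0 0) + 4 * weight2 p q (main_term 0 0))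
      * (val (main_term n k) 0 * harm (2 * n + k + 2) ^ 2)" for n k
    using derivative_bounds(2)[OF term_entries(1)[of n k], of p q]
    unfolding weight_independent(1)[of p n k] weight_independent(1)[of q n k] weight_independent(3)[of p q n k] by simp
  show "\<bar>deriv2 (carry_term n k) 0 p q\<bar> \<le> (4 * weight1 p (carry_term 0 0) * weight1 q (carry_term 0 0) + 4 * weight2 p q (carry_term 0 0))
      * (val (carry_term n k) 0 * harm (2 * n + k + 2) ^ 2)" for n k
    using derivative_bounds(2)[OF term_entries(2)[of n k], of p q]
    unfolding weight_independent(2)[of p n k] weight_independent(2)[of q n k] weight_independent(4)[of p q n k] by simp
qed (use assms weight_nonneg wz_identity_deriv2 in auto)

section \<open>Euler sums\<close>

text \<open>
  A nonnegative double series may be summed along rows or along diagonals. Applied to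
  \<open>1 / (p q\<^sup>s (p + q))\<close>, whose rows are telescoping and whose diagonals split into partial fractions, it yields
  linear relations between Euler sums.
\<close>
lemma rows_imp_diagonals_sums:
  fixes f :: "nat \<Rightarrow> nat \<Rightarrow> real"
  assumes nonneg: "\<And>p q. 0 \<le> f p q"
    and rows: "\<And>q. (\<lambda>p. f p q) sums R q" and R: "R sums S"
  shows "(\<lambda>m. \<Sum>i\<le>m. f i (m - i)) sums S"
proof -
  have rows': "((\<lambda>p. f p q) has_sum R q) UNIV" for q
    using rows nonneg by (rule sums_nonneg_imp_has_sum)
  have "0 \<le> R q" for q using nonneg rows by (intro sums_le[OF _ sums_zero rows]) auto
  then have R': "(R has_sum S) UNIV" by (intro sums_nonneg_imp_has_sum R)
  have "((\<lambda>(q, p). f p q) has_sum S) (UNIV \<times> UNIV)"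
    by (rule has_sum_SigmaI[OF _ R' summable_on_SigmaI[OF _ has_sum_imp_summable[OF R']]])
       (use rows' nonneg in auto)
  also have "((\<lambda>(q, p). f p q) has_sum S) (UNIV \<times> UNIV)
      = ((\<lambda>(m, i). f i (m - i)) has_sum S) (SIGMA m:UNIV. {..m})"
    by (rule has_sum_reindex_bij_witness[where i = "\<lambda>(m, i). (m - i, i)" and j = "\<lambda>(q, p). (q + p, p)"]) auto
  finally have "((\<lambda>m. \<Sum>i\<le>m. f i (m - i)) has_sum S) UNIV"
    by (rule has_sum_SigmaD) (auto intro!: has_sum_finite)
  then show ?thesis by (rule has_sum_imp_sums)
qed

lemma recip_sum_at_1: "recip_sum r m 1 = gen_harm r m"
  unfolding recip_sum_def gen_harm_def
  by (rule sum.reindex_bij_witness[of _ "\<lambda>j. j - 1" Suc]) auto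

lemma recip_sum_1_at_1: "recip_sum 1 m 1 = harm m"
  by (simp only: recip_sum_at_1 gen_harm_1)

lemma sum_atMost_rev: "(\<Sum>i\<le>m. g (m - i)) = (\<Sum>i\<le>m. g i)" for g :: "nat \<Rightarrow> real" and m :: nat
  by (rule sum.reindex_bij_witness[of _ "\<lambda>i. m - i" "\<lambda>i. m - i"]) auto

lemma sum_symmetrised:
  fixes g h :: "nat \<Rightarrow> real"
  shows "(\<Sum>i\<le>m. (g i + g (m - i)) * a + (h i + h (m - i)) * b) = 2 * sum g {..m} * a + 2 * sum h {..m} * b"
  using sum_atMost_rev[of g m] sum_atMost_rev[of h m]
  by (simp add: sum.distrib sum_distrib_right[symmetric])

lemma sum_inverse_powers: "(\<Sum>i\<le>m. 1 / (c + real i) ^ r) = recip_sum r (Suc m) c"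
  by (simp only: recip_sum_def lessThan_Suc_atMost)

lemma sums_shifted_difference: "(\<lambda>p. 1 / (real p + 1) - 1 / (real p + 1 + real q)) sums harm q"
proof (induction q)
  case 0
  then show ?case by (simp add: harm_def)
next
  case (Suc q)
  have "(\<lambda>p. 1 / (real p + 1 + real q)) \<longlonglongrightarrow> 0" by real_asymp
  from telescope_sums'[OF this]
  have "(\<lambda>p. 1 / (real p + 1 + real q) - 1 / (real (Suc p) + 1 + real q)) sums (1 / (1 + real q) - 0)"
    by simp
  from sums_add[OF Suc this] show ?case
    by (simp add: harm_Suc inverse_eq_divide add_ac)
qed

lemma sums_reciprocal_product: "(\<lambda>p. 1 / ((real p + 1) * (real p + real q + 2))) sums (harm (Suc q) / (real q + 1))"
proof -
  have "(\<lambda>p. (1 / (real q + 1)) * (1 / (real p + 1) - 1 / (real p + 1 + real (Suc q)))) sums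
      ((1 / (real q + 1)) * harm (Suc q))"
    by (intro sums_mult sums_shifted_difference)
  moreover have "(1 / (real q + 1)) * (1 / (real p + 1) - 1 / (real p + 1 + real (Suc q)))
      = 1 / ((real p + 1) * (real p + real q + 2))" for p
    by (simp add: divide_simps) (simp add: algebra_simps)
  ultimately show ?thesis by simp
qed

lemma harm_le_sqrt: "harm m \<le> 36 * sqrt (real m)"
proof (cases "m = 0")
  case False
  then have "harm m \<le> (harm m ^ 2 :: real)" using harm_ge_1[of m] power_increasing[of 1 2 "harm m :: real"] by simp
  then show ?thesis using harm_squared_le[of m] by linarith
qed (simp add: harm_def)

lemma summable_harm_over_square: "summable (\<lambda>k. harm (Suc k) / (real k + 1) ^ 2)"
proof (rule summable_comparison_test'[OF summable_mult[OF summable_sqrt_tail, of 36]])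
  fix k
  have "harm (Suc k) / (real k + 1) ^ 2 \<le> 36 * sqrt (real (Suc k)) / (real k + 1) ^ 2"
    by (intro divide_right_mono harm_le_sqrt) auto
  also have "\<dots> = 36 * (sqrt (real k + 1) / (real k + 1) ^ 2)" by (simp add: add.commute)
  finally show "norm (harm (Suc k) / (real k + 1) ^ 2) \<le> 36 * (1 / (real k + 1) powr (3 / 2))"
    by (simp add: sqrt_over_square harm_nonneg)
qed

lemma summable_inverse_power: "2 \<le> r \<Longrightarrow> summable (\<lambda>k. 1 / (real k + 1) ^ r)"
  using inverse_power_summable[of r, where ?'a = real] summable_Suc_iff[of "\<lambda>n. inverse (real n ^ r)"]
  by (simp add: inverse_eq_divide add.commute)

lemma summable_dominated_by_harm:
  assumes "\<And>k. 0 \<le> f k" "\<And>k. f k \<le> harm (Suc k) / (real k + 1) ^ 2"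
  shows "summable f"
  by (rule summable_comparison_test'[OF summable_harm_over_square]) (use assms in auto)

lemma gen_harm_nonneg: "0 \<le> gen_harm r k"
  by (auto simp: gen_harm_def intro!: sum_nonneg)

lemma gen_harm_2_le_harm: "gen_harm 2 k \<le> harm k"
  unfolding gen_harm_def harm_def
proof (rule sum_mono)
  fix j assume "j \<in> {1..k}"
  then show "1 / real j ^ 2 \<le> inverse (real j)" by (simp add: divide_simps power2_eq_square)
qed

lemma gen_harm_0: "gen_harm r 0 = 0"
  by (simp add: gen_harm_def)

lemma gen_harm_Suc: "gen_harm r (Suc k) = gen_harm r k + 1 / (real k + 1) ^ r"
  by (simp add: gen_harm_def add.commute)

lemma summable_harm_power: "2 \<le> r \<Longrightarrow> summable (\<lambda>k. harm k / (real k + 1) ^ r)"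
proof (rule summable_dominated_by_harm)
  fix k assume "2 \<le> r"
  then show "harm k / (real k + 1) ^ r \<le> harm (Suc k) / (real k + 1) ^ 2"
    by (intro frac_le harm_mono power_increasing) (auto simp: harm_nonneg)
qed (simp add: harm_nonneg)

lemma summable_gen_harm_square: "summable (\<lambda>k. gen_harm 2 k / (real k + 1) ^ 2)"
proof (rule summable_dominated_by_harm)
  fix k
  have "gen_harm 2 k \<le> harm (Suc k)"
    using gen_harm_2_le_harm[of k] harm_mono[of k "Suc k", where ?'a = real] by simp
  then show "gen_harm 2 k / (real k + 1) ^ 2 \<le> harm (Suc k) / (real k + 1) ^ 2"
    by (intro divide_right_mono) auto
qed (simp add: gen_harm_nonneg)

definition zeta_nat :: "nat \<Rightarrow> real" where
  "zeta_nat r = (\<Sum>k. 1 / (real k + 1) ^ r)"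

lemma zeta_nat_sums: "2 \<le> r \<Longrightarrow> (\<lambda>k. 1 / (real k + 1) ^ r) sums zeta_nat r"
  unfolding zeta_nat_def by (intro summable_sums summable_inverse_power)

lemma zeta_3: "zeta 3 = zeta_nat 3"
  unfolding zeta_def zeta_nat_def by (simp add: add.commute)

lemma harm_Suc_plus: "harm (Suc k) = harm k + 1 / (real k + 1)"
  by (simp add: harm_Suc inverse_eq_divide add.commute)

text \<open>
  Euler's evaluation. For \<open>1 / (p q (p + q))\<close> the rows give \<open>\<Sum> H\<^sub>q / q\<^sup>2\<close>; on the diagonal \<open>p + q = s\<close> one has
  \<open>1 / (p q) = (1 / p + 1 / q) / s\<close>, which gives \<open>2 \<Sum> H\<^bsub>s-1\<^esub> / s\<^sup>2\<close>. Since
  \<open>H\<^sub>q = H\<^bsub>q-1\<^esub> + 1 / q\<close>, the row total exceeds \<open>\<Sum> H\<^bsub>s-1\<^esub> / s\<^sup>2\<close> by \<open>\<zeta>(3)\<close>, so that series equals \<open>\<zeta>(3)\<close>.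
\<close>
lemma euler_sum_2: "(\<lambda>k. harm k / (real k + 1) ^ 2) sums zeta_nat 3"
proof -
  define f where "f p q = 1 / ((real p + 1) * (real q + 1) * (real p + real q + 2))" for p q :: nat
  obtain S where R: "(\<lambda>q. harm (Suc q) / (real q + 1) ^ 2) sums S"
    using summable_harm_over_square by (auto simp: summable_def)
  have rows: "(\<lambda>p. f p q) sums (harm (Suc q) / (real q + 1) ^ 2)" for q
    using sums_mult[OF sums_reciprocal_product[of q], of "1 / (real q + 1)"]
    by (simp add: f_def power2_eq_square mult_ac)
  have diag: "(\<Sum>i\<le>m. f i (m - i)) = 2 * (harm (Suc m) / (real (Suc m) + 1) ^ 2)" for m
  proof -
    have "(\<Sum>i\<le>m. f i (m - i)) = (\<Sum>i\<le>m. (1 / (1 + real i) ^ 1 + 1 / (1 + real (m - i)) ^ 1) / (real m + 2) ^ 2)"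
    proof (rule sum.cong)
      fix i assume "i \<in> {..m}"
      moreover have term_eq: "1 / (x * y * s) = (1 / x ^ 1 + 1 / y ^ 1) / s ^ 2" if "0 < x" "0 < y" "x + y = s"
        for x y s :: real
        using that by (simp add: divide_simps power2_eq_square)
      ultimately show "f i (m - i) = (1 / (1 + real i) ^ 1 + 1 / (1 + real (m - i)) ^ 1) / (real m + 2) ^ 2"
        by (subst term_eq[symmetric]) (auto simp: f_def of_nat_diff add_ac)
    qed simp
    also have "\<dots> = 2 * (\<Sum>i\<le>m. 1 / (1 + real i) ^ 1) / (real m + 2) ^ 2"
      using sum_atMost_rev[of "\<lambda>i. 1 / (1 + real i) ^ 1" m]
      by (simp add: sum_divide_distrib[symmetric] sum.distrib)
    also have "\<dots> = 2 * (harm (Suc m) / (real (Suc m) + 1) ^ 2)"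
      unfolding sum_inverse_powers recip_sum_1_at_1 by (simp add: add.commute)
    finally show ?thesis .
  qed
  have "(\<lambda>m. 2 * (harm (Suc m) / (real (Suc m) + 1) ^ 2)) sums S"
    using rows_imp_diagonals_sums[OF _ rows R] unfolding diag by (simp add: f_def)
  from sums_mult[OF this, of "1 / 2"]
  have half: "(\<lambda>k. harm k / (real k + 1) ^ 2) sums (S / 2)"
    using sums_Suc_iff[of "\<lambda>k. harm k / (real k + 1) ^ 2" "S / 2"] by (simp add: harm_expand(1))
  have "(\<lambda>k. harm k / (real k + 1) ^ 2 + 1 / (real k + 1) ^ 3) sums (S / 2 + zeta_nat 3)"
    by (intro sums_add half zeta_nat_sums) simp
  also have "(\<lambda>k. harm k / (real k + 1) ^ 2 + 1 / (real k + 1) ^ 3) = (\<lambda>k. harm (Suc k) / (real k + 1) ^ 2)"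
    by (auto simp: harm_Suc_plus add_divide_distrib power2_eq_square power3_eq_cube)
  finally have "S / 2 + zeta_nat 3 = S" using R by (metis sums_unique2)
  then have "S / 2 = zeta_nat 3" by simp
  with half show ?thesis by simp
qed

text \<open>
  Square the partial fraction \<open>1 / (x y) = (1 / x + 1 / y) / s\<close> for \<open>x + y = s\<close>, where \<open>x\<close> and \<open>y\<close> run
  through \<open>c + i\<close> and \<open>c + (m - i)\<close>, and expand the remaining product \<open>2 / (x y)\<close> once more. The cases
  \<open>c = 1\<close> and \<open>c = 1/2\<close> are used, for integers and for half-integers.
\<close>
lemma convolution_of_inverse_squares:
  fixes c :: real
  assumes "0 < c"
  shows "(\<Sum>i\<le>m. 1 / (c + real i) ^ 2 * (1 / (c + real (m - i)) ^ 2))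
     = 2 * recip_sum 2 (Suc m) c / (real m + 2 * c) ^ 2 + 4 * recip_sum 1 (Suc m) c / (real m + 2 * c) ^ 3"
proof -
  define s where "s = real m + 2 * c"
  have s: "0 < s" using assms by (simp add: s_def)
  define t where "t = 2 / s ^ 3"
  have term_eq: "1 / x ^ 2 * (1 / y ^ 2) = (1 / x ^ 2 + 1 / y ^ 2) / s ^ 2 + (1 / x ^ 1 + 1 / y ^ 1) * t"
    if "0 < x" "0 < y" "x + y = s" for x y
  proof -
    have "(1 / x ^ 2 + 1 / y ^ 2) / s ^ 2 + (1 / x ^ 1 + 1 / y ^ 1) * t
       = ((x ^ 2 + y ^ 2) * s + 2 * x * y * (x + y)) / (x ^ 2 * y ^ 2 * s ^ 3)"
      using that(1,2) s by (simp add: divide_simps t_def) algebra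
    also have "(x ^ 2 + y ^ 2) * s + 2 * x * y * (x + y) = s ^ 3"
      unfolding that(3)[symmetric] by algebra
    finally show ?thesis using that(1,2) s by simp
  qed
  have "(\<Sum>i\<le>m. 1 / (c + real i) ^ 2 * (1 / (c + real (m - i)) ^ 2)) =
     (\<Sum>i\<le>m. (1 / (c + real i) ^ 2 + 1 / (c + real (m - i)) ^ 2) / s ^ 2
          + (1 / (c + real i) ^ 1 + 1 / (c + real (m - i)) ^ 1) * t)"
    using assms by (intro sum.cong refl term_eq) (auto simp: s_def of_nat_diff)
  also have "\<dots> = 2 * recip_sum 2 (Suc m) c / s ^ 2 + 4 * recip_sum 1 (Suc m) c / s ^ 3"
    unfolding sum_inverse_powers[symmetric]
    using sum_symmetrised[of "\<lambda>i. 1 / (c + real i) ^ 2" m "1 / s ^ 2" "\<lambda>i. 1 / (c + real i) ^ 1" t]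
    by (simp add: t_def)
  finally show ?thesis by (simp add: s_def)
qed

lemma square_of_inverse_squares_sums:
  fixes c :: real
  assumes c: "0 < c" and T: "(\<lambda>k. 1 / (c + real k) ^ 2) sums T"
  shows "(\<lambda>m. 2 * recip_sum 2 (Suc m) c / (real m + 2 * c) ^ 2 + 4 * recip_sum 1 (Suc m) c / (real m + 2 * c) ^ 3) sums T\<^sup>2"
proof -
  have "summable (\<lambda>k. norm (1 / (c + real k) ^ 2))"
    using sums_summable[OF T] by simp
  from Cauchy_product_sums[OF this this] show ?thesis
    unfolding convolution_of_inverse_squares[OF c] sums_unique[OF T, symmetric] power2_eq_square[of T] .
qed

lemma zeta_nat_2: "zeta_nat 2 = pi\<^sup>2 / 6"
proof (rule sums_unique2)
  show "(\<lambda>k. 1 / (real k + 1) ^ 2) sums zeta_nat 2" by (rule zeta_nat_sums) simp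
  show "(\<lambda>k. 1 / (real k + 1) ^ 2) sums (pi\<^sup>2 / 6)" using inverse_squares_sums by (simp add: add.commute)
qed

text \<open>
  Write \<open>U\<close> and \<open>V\<close> for the series of \<open>H\<^bsub>q-1\<^esub> / q\<^sup>3\<close> and of \<open>H\<^sup>(\<^sup>2\<^sup>)\<^bsub>q-1\<^esub> / q\<^sup>2\<close>, and \<open>Z\<^sub>r\<close> for \<open>\<zeta>(r)\<close>. The Cauchy square of \<open>\<zeta>(2)\<close> gives
  \<open>Z\<^sub>2\<^sup>2 = 2 V + 4 U\<close>, splitting the square at the diagonal gives \<open>Z\<^sub>2\<^sup>2 = Z\<^sub>4 + 2 V\<close>, and summing
  \<open>1 / (p q\<^sup>2 (p + q))\<close> by rows and by diagonals gives \<open>U + Z\<^sub>4 = 2 U + V\<close>. The three equations determine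
  \<open>U\<close>, \<open>V\<close> and \<open>Z\<^sub>4\<close> from \<open>Z\<^sub>2 = \<pi>\<^sup>2 / 6\<close>.
\<close>
lemma euler_sums_4:
  shows zeta_nat_4: "zeta_nat 4 = pi ^ 4 / 90"
    and euler_sum_3_1: "(\<lambda>k. harm k / (real k + 1) ^ 3) sums (zeta_nat 4 / 4)"
    and euler_sum_2_2: "(\<lambda>k. gen_harm 2 k / (real k + 1) ^ 2) sums (3 / 4 * zeta_nat 4)"
proof -
  obtain U where U: "(\<lambda>k. harm k / (real k + 1) ^ 3) sums U"
    using summable_harm_power[of 3] by (auto simp: summable_def)
  obtain V where V: "(\<lambda>k. gen_harm 2 k / (real k + 1) ^ 2) sums V"
    using summable_gen_harm_square by (auto simp: summable_def)
  have U': "(\<lambda>m. harm (Suc m) / (real m + 2) ^ 3) sums U"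
    using U sums_Suc_iff[of "\<lambda>k. harm k / (real k + 1) ^ 3" U] by (simp add: harm_expand(1) add_ac)
  have V': "(\<lambda>m. gen_harm 2 (Suc m) / (real m + 2) ^ 2) sums V"
    using V sums_Suc_iff[of "\<lambda>k. gen_harm 2 k / (real k + 1) ^ 2" V] by (simp add: gen_harm_0 add_ac)
  have "(\<lambda>m. 2 * recip_sum 2 (Suc m) 1 / (real m + 2 * 1) ^ 2 + 4 * recip_sum 1 (Suc m) 1 / (real m + 2 * 1) ^ 3) sums (zeta_nat 2)\<^sup>2"
    using zeta_nat_sums[of 2] by (intro square_of_inverse_squares_sums) (auto simp: add.commute)
  moreover have "(\<lambda>m. 2 * (gen_harm 2 (Suc m) / (real m + 2) ^ 2) + 4 * (harm (Suc m) / (real m + 2) ^ 3)) sums (2 * V + 4 * U)"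
    by (intro sums_add sums_mult U' V')
  ultimately have eq1: "(zeta_nat 2)\<^sup>2 = 2 * V + 4 * U"
    unfolding recip_sum_1_at_1 recip_sum_at_1[of 2] by (simp add: sums_iff)
  have "(\<Sum>k<N. 1 / (real k + 1) ^ 2)\<^sup>2 = (\<Sum>k<N. 1 / (real k + 1) ^ 4 + 2 * (gen_harm 2 k / (real k + 1) ^ 2))" for N
  proof (induction N)
    case (Suc N)
    have "(\<Sum>k<N. 1 / (real k + 1) ^ 2) = gen_harm 2 N"
      unfolding recip_sum_at_1[symmetric] by (simp add: recip_sum_def add.commute)
    moreover have "(1 / (real N + 1) ^ 2) ^ 2 = 1 / (real N + 1) ^ 4"
      by (simp add: power_divide flip: power_mult)
    ultimately show ?case
      using Suc power2_sum[of "gen_harm 2 N" "1 / (real N + 1) ^ 2"] by simp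
  qed simp
  moreover have "(\<lambda>N. (\<Sum>k<N. 1 / (real k + 1) ^ 2)\<^sup>2) \<longlonglongrightarrow> (zeta_nat 2)\<^sup>2"
    using zeta_nat_sums[of 2] unfolding sums_def by (intro tendsto_power) auto
  ultimately have "(\<lambda>k. 1 / (real k + 1) ^ 4 + 2 * (gen_harm 2 k / (real k + 1) ^ 2)) sums (zeta_nat 2)\<^sup>2"
    by (simp add: sums_def)
  moreover have "(\<lambda>k. 1 / (real k + 1) ^ 4 + 2 * (gen_harm 2 k / (real k + 1) ^ 2)) sums (zeta_nat 4 + 2 * V)"
    by (intro sums_add sums_mult V zeta_nat_sums) simp
  ultimately have eq2: "(zeta_nat 2)\<^sup>2 = zeta_nat 4 + 2 * V" by (rule sums_unique2)

  define f where "f p q = 1 / ((real p + 1) * (real q + 1) ^ 2 * (real p + real q + 2))" for p q :: nat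
  have R: "(\<lambda>q. harm (Suc q) / (real q + 1) ^ 3) sums (U + zeta_nat 4)"
    using sums_add[OF U zeta_nat_sums[of 4]]
    by (simp add: harm_Suc_plus add_divide_distrib power3_eq_cube power4_eq_xxxx mult.assoc)
  have rows: "(\<lambda>p. f p q) sums (harm (Suc q) / (real q + 1) ^ 3)" for q
    using sums_mult[OF sums_reciprocal_product[of q], of "1 / (real q + 1) ^ 2"]
    by (simp add: f_def power2_eq_square power3_eq_cube mult_ac)
  have diag: "(\<Sum>i\<le>m. f i (m - i)) = 2 * (harm (Suc m) / (real m + 2) ^ 3) + gen_harm 2 (Suc m) / (real m + 2) ^ 2" for m
  proof -
    have term_eq: "1 / (x * y ^ 2 * s) = (1 / x ^ 1 + 1 / y ^ 1) / s ^ 3 + 1 / y ^ 2 / s ^ 2"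
      if "0 < x" "0 < y" "x + y = s" for x y s :: real
    proof -
      have s: "0 < s" using that by simp
      have "(1 / x ^ 1 + 1 / y ^ 1) / s ^ 3 + 1 / y ^ 2 / s ^ 2
         = ((x + y) * y + x * s) / (x * y ^ 2 * s ^ 3)"
        using that(1,2) s by (simp add: divide_simps) algebra
      also have "(x + y) * y + x * s = s ^ 2"
        unfolding that(3)[symmetric] by algebra
      finally show ?thesis using that(1,2) s by (simp add: power2_eq_square power3_eq_cube)
    qed
    have "(\<Sum>i\<le>m. f i (m - i)) = (\<Sum>i\<le>m. (1 / (1 + real i) ^ 1 + 1 / (1 + real (m - i)) ^ 1) / (real m + 2) ^ 3
        + 1 / (1 + real (m - i)) ^ 2 / (real m + 2) ^ 2)"
    proof (rule sum.cong)
      fix i assume "i \<in> {..m}"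
      then show "f i (m - i) = (1 / (1 + real i) ^ 1 + 1 / (1 + real (m - i)) ^ 1) / (real m + 2) ^ 3
          + 1 / (1 + real (m - i)) ^ 2 / (real m + 2) ^ 2"
        by (subst term_eq[symmetric]) (auto simp: f_def of_nat_diff add_ac)
    qed simp
    also have "\<dots> = 2 * (\<Sum>i\<le>m. 1 / (1 + real i) ^ 1) / (real m + 2) ^ 3 + (\<Sum>i\<le>m. 1 / (1 + real i) ^ 2) / (real m + 2) ^ 2"
      using sum_atMost_rev[of "\<lambda>i. 1 / (1 + real i) ^ 1" m] sum_atMost_rev[of "\<lambda>i. 1 / (1 + real i) ^ 2" m]
      by (simp add: sum_divide_distrib[symmetric] sum.distrib del: divide_divide_eq_left)
    finally show ?thesis
      unfolding sum_inverse_powers recip_sum_1_at_1 recip_sum_at_1[of 2] by simp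
  qed
  have "(\<lambda>m. 2 * (harm (Suc m) / (real m + 2) ^ 3) + gen_harm 2 (Suc m) / (real m + 2) ^ 2) sums (U + zeta_nat 4)"
    using rows_imp_diagonals_sums[OF _ rows R] unfolding diag by (simp add: f_def)
  moreover have "(\<lambda>m. 2 * (harm (Suc m) / (real m + 2) ^ 3) + gen_harm 2 (Suc m) / (real m + 2) ^ 2) sums (2 * U + V)"
    by (intro sums_add sums_mult U' V')
  ultimately have eq3: "U + zeta_nat 4 = 2 * U + V" by (rule sums_unique2)
  have "(zeta_nat 2)\<^sup>2 = pi ^ 4 / 36" unfolding zeta_nat_2 by (simp add: power_divide flip: power_mult)
  then show "zeta_nat 4 = pi ^ 4 / 90" using eq1 eq2 eq3 by simp
  have UV: "U = zeta_nat 4 / 4" "V = 3 / 4 * zeta_nat 4" using eq1 eq2 eq3 by simp_all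
  show "(\<lambda>k. harm k / (real k + 1) ^ 3) sums (zeta_nat 4 / 4)"
    using U unfolding UV(1) .
  show "(\<lambda>k. gen_harm 2 k / (real k + 1) ^ 2) sums (3 / 4 * zeta_nat 4)"
    using V unfolding UV(2) .
qed

lemma odd_inverse_squares_sums: "(\<lambda>k. 1 / (1 / 2 + real k) ^ 2) sums (pi\<^sup>2 / 2)"
proof -
  have "(\<lambda>n. \<Sum>k\<in>{n * 2..<n * 2 + 2}. 1 / (real k + 1) ^ 2) sums zeta_nat 2"
    by (intro sums_group zeta_nat_sums) auto
  moreover have "(\<Sum>k\<in>{n * 2..<n * 2 + 2}. 1 / (real k + 1) ^ 2)
      = 1 / 4 * (1 / (1 / 2 + real n) ^ 2) + 1 / 4 * (1 / (real n + 1) ^ 2)" for n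
  proof -
    have "{n * 2..<n * 2 + 2} = {2 * n, 2 * n + 1}" by auto
    moreover have "(real (2 * n) + 1) ^ 2 = 4 * (1 / 2 + real n) ^ 2"
      "(real (2 * n + 1) + 1) ^ 2 = 4 * (real n + 1) ^ 2"
      by (simp_all add: power2_eq_square algebra_simps)
    then have "1 / (real (2 * n) + 1) ^ 2 = 1 / 4 * (1 / (1 / 2 + real n) ^ 2)"
      "1 / (real (2 * n + 1) + 1) ^ 2 = 1 / 4 * (1 / (real n + 1) ^ 2)"
      by simp_all
    ultimately show ?thesis by simp
  qed
  ultimately have "(\<lambda>n. 1 / 4 * (1 / (1 / 2 + real n) ^ 2) + 1 / 4 * (1 / (real n + 1) ^ 2)) sums zeta_nat 2"
    by simp
  from sums_diff[OF this sums_mult[OF zeta_nat_sums[of 2], of "1 / 4"]]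
  have "(\<lambda>n. 1 / 4 * (1 / (1 / 2 + real n) ^ 2)) sums (3 / 4 * zeta_nat 2)" by simp
  from sums_mult[OF this, of 4] show ?thesis by (simp add: zeta_nat_2)
qed

text \<open>
  The two half-integer Euler sums are needed only in this combination, which is again a Cauchy square;
  each of them alone would involve alternating sums of a less elementary kind.
\<close>
lemma odd_euler_sum:
  "(\<lambda>k. 2 * recip_sum 2 (Suc k) (1 / 2) / (real k + 1) ^ 2 + 4 * recip_sum 1 (Suc k) (1 / 2) / (real k + 1) ^ 3)
     sums (45 / 2 * zeta_nat 4)"
  using square_of_inverse_squares_sums[OF _ odd_inverse_squares_sums]
  by (simp add: zeta_nat_4 power_divide flip: power_mult)

section \<open>Logarithmic derivatives at the base point\<close>

lemma recip_sum_1_half: "recip_sum 1 m (1 / 2) = 2 * harm (2 * m) - harm m"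
proof (induction m)
  case (Suc m)
  have "1 / (1 / 2 + real m) = 2 / (2 * real m + 1)" by (simp add: divide_simps)
  moreover have "(2 :: real) / (2 * real m + 2) = 1 / (real m + 1)" by (simp add: divide_simps)
  ultimately show ?case using Suc
    by (simp add: recip_sum_def harm_Suc_plus add_ac)
qed (simp add: recip_sum_def harm_expand(1))

lemma recip_sum_2_half: "recip_sum 2 m (1 / 2) = 4 * gen_harm 2 (2 * m) - gen_harm 2 m"
proof (induction m)
  case (Suc m)
  have "1 / (1 / 2 + real m) ^ 2 = 4 * (1 / (2 * real m + 1) ^ 2)"
    by (simp add: divide_simps power2_eq_square) (simp add: algebra_simps)
  moreover have "4 * (1 / (2 * real m + 2) ^ 2) = 1 / (real m + 1) ^ 2"
    by (simp add: divide_simps power2_eq_square) (simp add: algebra_simps)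
  ultimately show ?case using Suc
    by (simp add: recip_sum_def gen_harm_Suc add_ac)
qed (simp add: recip_sum_def gen_harm_0)

lemma recip_sum_0: "recip_sum r 0 c = 0"
  by (simp add: recip_sum_def)

lemma recip_sum_singleton: "recip_sum r (Suc 0) c = 1 / c ^ r"
  by (simp add: recip_sum_def)

lemmas dlog_eval = dlog_def dlogs_def fst_conv snd_conv list.map prod.case sum_list.Cons sum_list.Nil
  inner_forms inner_zero_right add_0_right recip_sum_1_at_1 recip_sum_singleton power_one_right

lemma dlog_main:
  "dlog (main_term n k) 0 (a, b, c, d, e) =
     a / (2 + 3 * real n + 2 * real k) + (b + c + d) * harm (n + k) + e * recip_sum 1 (2 * n + k + 1) (1 / 2)
     - (3 * a - b - c - d) * harm (2 * n + k + 1) - (a - e) * recip_sum 1 (n + k + 1) (1 / 2)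
     + (3 * a - 2 * (b + c + d)) * harm n - (2 * a - b - c - d - e) * recip_sum 1 n (1 / 2)"
  unfolding main_term_def dlog_eval by (simp add: recip_sum_singleton algebra_simps)

lemma dlog_carry:
  "dlog (carry_term n k) 0 (a, b, c, d, e) =
     (2 * a - b - c - d) / (3 + 3 * real n + real k) + (b + c + d) * harm (n + k + 1)
     + e * recip_sum 1 (2 * n + k + 2) (1 / 2)
     - (3 * a - b - c - d) * harm (2 * n + k + 2) - (a - e) * recip_sum 1 (n + k + 1) (1 / 2)
     + (3 * a - 2 * (b + c + d)) * harm n - (2 * a - b - c - d - e) * recip_sum 1 (n + 1) (1 / 2)"
  unfolding carry_term_def dlog_eval by (simp add: recip_sum_singleton algebra_simps diff_divide_distrib add_divide_distrib)

lemmas ddlog_eval = ddlog_def ddlogs_def fst_conv snd_conv list.map prod.case sum_list.Cons sum_list.Nil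
  inner_forms inner_zero_right add_0_right recip_sum_at_1 recip_sum_singleton

lemma ddlog_main:
  "ddlog (main_term n k) 0 (a, b, c, d, e) (a', b', c', d', e') =
     - (a * a' / (2 + 3 * real n + 2 * real k)\<^sup>2 + (b * b' + c * c' + d * d') * gen_harm 2 (n + k)
        + e * e' * recip_sum 2 (2 * n + k + 1) (1 / 2)
        - ((a - b) * (a' - b') + (a - c) * (a' - c') + (a - d) * (a' - d')) * gen_harm 2 (2 * n + k + 1)
        - (a - e) * (a' - e') * recip_sum 2 (n + k + 1) (1 / 2)
        + ((a - b - c) * (a' - b' - c') + (a - b - d) * (a' - b' - d') + (a - c - d) * (a' - c' - d')) * gen_harm 2 n
        - (2 * a - b - c - d - e) * (2 * a' - b' - c' - d' - e') * recip_sum 2 n (1 / 2))"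
  unfolding main_term_def ddlog_eval by (simp add: recip_sum_singleton distrib_right)

lemma ddlog_carry:
  "ddlog (carry_term n k) 0 (a, b, c, d, e) (a', b', c', d', e') =
     - ((2 * a - b - c - d) * (2 * a' - b' - c' - d') / (3 + 3 * real n + real k)\<^sup>2
        + (b * b' + c * c' + d * d') * gen_harm 2 (n + k + 1)
        + e * e' * recip_sum 2 (2 * n + k + 2) (1 / 2)
        - ((a - b) * (a' - b') + (a - c) * (a' - c') + (a - d) * (a' - d')) * gen_harm 2 (2 * n + k + 2)
        - (a - e) * (a' - e') * recip_sum 2 (n + k + 1) (1 / 2)
        + ((a - b - c) * (a' - b' - c') + (a - b - d) * (a' - b' - d') + (a - c - d) * (a' - c' - d')) * gen_harm 2 n
        - (2 * a - b - c - d - e) * (2 * a' - b' - c' - d' - e') * recip_sum 2 (n + 1) (1 / 2))"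
  unfolding carry_term_def ddlog_eval by (simp add: recip_sum_singleton distrib_right)

section \<open>The values at the base point\<close>

definition sun_weight :: "nat \<Rightarrow> real" where
  "sun_weight k = real ((4 * k) choose (2 * k)) / ((4 * real k - 1) * real k ^ 3 * real ((2 * k) choose k) ^ 4)"

text \<open>
  The two polynomials add up to \<open>60 k\<^sup>2 - 43 k + 8\<close>: this is where \<open>Q\<close> comes from. The column variable
  is \<open>n = k - 1\<close>.
\<close>
lemma base_values:
  fixes n :: nat
  defines "k \<equiv> Suc n"
  shows "val (main_term n 0) 0 = sun_weight k * (8 * (3 * real k - 1) * (2 * real k - 1))"
    and "val (carry_term n 0) 0 = sun_weight k * (3 * real k * (4 * real k - 1))"
proof -
  define x X Y Z :: real where "x = real n" and "X = fact n" and "Y = fact (2 * n)" and "Z = fact (4 * n)"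
  have pos: "0 < X" "0 < Y" "0 < Z" "0 \<le> x" by (auto simp: X_def Y_def Z_def x_def)
  define e :: real where "e = 4 ^ n"
  have e: "0 < e" by (simp add: e_def)
  have ph: "pochhammer (1 / 2 :: real) m = fact (2 * m) / (4 ^ m * fact m)" for m
    using fact_double[of m, where ?'a = real] by (simp add: power_mult)
  have p1: "pochhammer (1 / 2) n = Y / (e * X)" by (simp add: ph X_def Y_def e_def)
  have "(4 :: real) ^ (2 * n) = e ^ 2" by (simp add: e_def mult.commute power_mult)
  then have p2: "pochhammer (1 / 2) (2 * n) = Z / (e ^ 2 * Y)" by (simp add: ph Y_def Z_def)
  have p3: "pochhammer (1 / 2) (Suc n) = Y / (e * X) * (1 / 2 + x)"
    "pochhammer (1 / 2) (Suc (2 * n)) = Z / (e ^ 2 * Y) * (1 / 2 + 2 * x)"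
    "pochhammer (1 / 2) (Suc (Suc (2 * n))) = Z / (e ^ 2 * Y) * (1 / 2 + 2 * x) * (1 / 2 + (2 * x + 1))"
    by (simp_all only: pochhammer_Suc p1 p2) (simp_all add: x_def)
  have f: "fact (Suc n) = (x + 1) * X" "fact (Suc (2 * n)) = (2 * x + 1) * Y"
    "fact (Suc (Suc (2 * n))) = (2 * x + 2) * ((2 * x + 1) * Y)"
    by (simp_all add: X_def Y_def x_def algebra_simps)
  have four: "4 * Suc n = Suc (Suc (Suc (Suc (4 * n))))" by simp
  have f4: "fact (4 * Suc n) = (4 * x + 4) * ((4 * x + 3) * ((4 * x + 2) * ((4 * x + 1) * Z)))"
    unfolding four fact_Suc by (simp add: Z_def x_def add_ac)
  have b1: "real ((2 * k) choose k) = (2 * x + 2) * ((2 * x + 1) * Y) / ((x + 1) * X) ^ 2"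
    using binomial_fact[of k "2 * k", where ?'a = real] f
    by (simp add: k_def power2_eq_square del: fact_Suc)
  have b2: "real ((4 * k) choose (2 * k)) = (4 * x + 4) * ((4 * x + 3) * ((4 * x + 2) * ((4 * x + 1) * Z)))
       / ((2 * x + 2) * ((2 * x + 1) * Y)) ^ 2"
    using binomial_fact[of "2 * k" "4 * k", where ?'a = real] f4 f(3)
    by (simp add: k_def power2_eq_square del: fact_Suc)
  have k: "real k = x + 1" by (simp add: k_def x_def)
  have w: "sun_weight k = (4 * x + 4) * ((4 * x + 3) * ((4 * x + 2) * ((4 * x + 1) * Z))) / ((2 * x + 2) * ((2 * x + 1) * Y)) ^ 2
     / ((4 * x + 3) * (x + 1) ^ 3 * ((2 * x + 2) * ((2 * x + 1) * Y) / ((x + 1) * X) ^ 2) ^ 4)"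
    unfolding sun_weight_def b1 b2 k by (simp add: algebra_simps)
  \<comment> \<open>The linear factors are kept as opaque positive numbers, so that only monomials are compared.\<close>
  define A B C D where "A = x + 1" and "B = 2 * x + 1" and "C = 4 * x + 1" and "D = 4 * x + 3"
  have ABCD: "0 < A" "0 < B" "0 < C" "0 < D" using pos by (auto simp: A_def B_def C_def D_def)
  have lin: "x + 1 = A" "2 * x + 1 = B" "4 * x + 1 = C" "4 * x + 3 = D" "2 * x + 2 = 2 * A"
    "4 * x + 4 = 4 * A" "4 * x + 2 = 2 * B" "1 / 2 + x = B / 2" "1 / 2 + 2 * x = C / 2"
    "1 / 2 + B = D / 2" "3 + 3 * x + 0 = 3 * A" "2 * A - 1 = B" "4 * A - 1 = D"
    by (simp_all add: A_def B_def C_def D_def field_simps)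
  have w': "sun_weight k = Z * X ^ 8 * C / (B ^ 5 * Y ^ 6) / 8"
    unfolding w lin using ABCD pos
    by (simp add: divide_simps power_mult_distrib eval_nat_numeral)
  have F: "val (main_term n 0) 0 = (2 + 3 * x + 2 * 0) * (X ^ 3 * (Z / (e ^ 2 * Y) * (C / 2)) * X ^ 3) /
      ((B * Y) ^ 3 * (Y / (e * X) * (B / 2)) * (Y / (e * X)))"
    using val_main_0[of n 0] p1 p3 f unfolding lin
    by (simp add: X_def[symmetric] x_def[symmetric] del: fact_Suc)
  show "val (main_term n 0) 0 = sun_weight k * (8 * (3 * real k - 1) * (2 * real k - 1))"
    unfolding F w' k lin using ABCD pos e
    by (simp add: divide_simps eval_nat_numeral) (simp add: A_def)
  have M: "val (carry_term n 0) 0 = (3 + 3 * x + 0) * ((A * X) ^ 3 * (Z / (e ^ 2 * Y) * (C / 2) * (D / 2)) * X ^ 3) /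
      ((2 * A * (B * Y)) ^ 3 * (Y / (e * X) * (B / 2)) * (Y / (e * X) * (B / 2)))"
    using val_carry_0[of n 0] p1 p3 f lin(11) unfolding lin(1-10)
    by (simp add: mult_ac X_def[symmetric] x_def[symmetric] del: fact_Suc)
  show "val (carry_term n 0) 0 = sun_weight k * (3 * real k * (4 * real k - 1))"
    unfolding M w' k lin using ABCD pos e
    by (simp add: divide_simps eval_nat_numeral)
qed

section \<open>The four directions: sums of the top row\<close>

text \<open>
  In column 0 the first logarithmic derivative along \<open>(a, b, c, d, e)\<close> is, up to rational functions of
  \<open>n\<close>, a combination of \<open>u = 3 a - b - c - d\<close> and \<open>e\<close> with harmonic numbers as coefficients. A direction
  with \<open>u \<noteq> 0\<close> and \<open>e = 0\<close>, such as \<open>along_b\<close>, isolates \<open>3 H\<^bsub>2k-1\<^esub> - 2 H\<^bsub>k-1\<^esub>\<close>. The direction \<open>along_shift\<close> has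
  \<open>e \<noteq> 0\<close>, so it brings in \<open>H\<^bsub>4k-1\<^esub>\<close>, and it moves \<open>k + 1\<close> to \<open>k + 1 + t\<close> in row 0, where the
  terms become \<open>2 / (k + 1 + t)\<^sup>2\<close>. For a second derivative not to contain products of harmonic numbers, one of
  the two directions should have \<open>u = e = 0\<close>; this is the case for \<open>along_split\<close> and \<open>along_null\<close>.
\<close>
abbreviation along_b :: params where "along_b \<equiv> (0, 1, 0, 0, 0)"
abbreviation along_shift :: params where "along_shift \<equiv> (2, 1, 1, 1, 1)"
abbreviation along_split :: params where "along_split \<equiv> (0, 1, - 1, 0, 0)"
abbreviation along_null :: params where "along_null \<equiv> (1, 1, 1, 1, 0)"

lemma val_top_row: "val (main_term 0 k) 0 = 2 / (real k + 1) ^ 2"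
proof -
  have "val (main_term 0 k) 0 = 2 * (real k + 1) * (fact k / fact (Suc k)) ^ 3"
    unfolding val_main_0 using pochhammer_half_pos[of "Suc k"] by (simp add: power_divide del: fact_Suc)
  also have "fact k / fact (Suc k) = 1 / (real k + 1)" by (simp add: divide_simps)
  finally have v: "val (main_term 0 k) 0 = 2 * (real k + 1) * (1 / (real k + 1)) ^ 3" .
  have "2 * x * (1 / x) ^ 3 = 2 / x ^ 2" if "x \<noteq> 0" for x :: real
    using that by (simp add: divide_simps eval_nat_numeral)
  from this[of "real k + 1"] show ?thesis unfolding v by simp
qed

text \<open>
  Along \<open>b\<close> only the factors with \<open>b\<close> move, and the terms of row 0 become \<open>2 / K\<^sup>2\<close> times
  \<open>H\<^bsub>K-1\<^esub> + H\<^sub>K\<close>, where \<open>K = k + 1\<close>.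
\<close>
lemma row_u: "(\<lambda>k. deriv1 (main_term 0 k) 0 along_b) sums (6 * zeta_nat 3)"
proof -
  have "deriv1 (main_term 0 k) 0 along_b = 4 * (harm k / (real k + 1) ^ 2) + 2 * (1 / (real k + 1) ^ 3)" for k
    by (simp add: deriv1_def val_top_row dlog_main recip_sum_0 harm_expand(1) harm_Suc_plus add_divide_distrib eval_nat_numeral algebra_simps)
  moreover have "(\<lambda>k. 4 * (harm k / (real k + 1) ^ 2) + 2 * (1 / (real k + 1) ^ 3)) sums (4 * zeta_nat 3 + 2 * zeta_nat 3)"
    by (intro sums_add sums_mult euler_sum_2 zeta_nat_sums) simp
  ultimately show ?thesis by simp
qed

lemma dlog_row_shift: "dlog (main_term 0 k) 0 along_shift = - 2 / (real k + 1)"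
proof -
  have "2 / (2 + 2 * real k) = 1 / (real k + 1)" by (simp add: divide_simps)
  then show ?thesis by (simp add: dlog_main recip_sum_0 harm_expand(1) harm_Suc_plus add_ac)
qed

lemma row_shift: "(\<lambda>k. deriv1 (main_term 0 k) 0 along_shift) sums (- 4 * zeta_nat 3)"
proof -
  have "deriv1 (main_term 0 k) 0 along_shift = - 4 * (1 / (real k + 1) ^ 3)" for k
    unfolding deriv1_def val_top_row dlog_row_shift by (simp add: eval_nat_numeral)
  moreover have "(\<lambda>k. - 4 * (1 / (real k + 1) ^ 3)) sums (- 4 * zeta_nat 3)"
    by (intro sums_mult zeta_nat_sums) simp
  ultimately show ?thesis by simp
qed

text \<open>
  Along \<open>(0, t, -t, 0, 0)\<close> the terms of row 0 are \<open>2 / (K\<^sup>2 - t\<^sup>2)\<close> with \<open>K = k + 1\<close>: the first derivative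
  at \<open>t = 0\<close> vanishes and the second one is \<open>4 / K\<^sup>4\<close>.
\<close>
lemma row_split: "(\<lambda>k. deriv2 (main_term 0 k) 0 along_split along_split) sums (4 * zeta_nat 4)"
proof -
  have "deriv2 (main_term 0 k) 0 along_split along_split = 4 * (1 / (real k + 1) ^ 4)" for k
  proof -
    have "dlog (main_term 0 k) 0 along_split = 0" by (simp add: dlog_main)
    moreover have "ddlog (main_term 0 k) 0 along_split along_split = 2 / (real k + 1) ^ 2"
      by (simp add: ddlog_main gen_harm_Suc gen_harm_0)
    ultimately show ?thesis unfolding deriv2_def val_top_row by (simp add: eval_nat_numeral)
  qed
  moreover have "(\<lambda>k. 4 * (1 / (real k + 1) ^ 4)) sums (4 * zeta_nat 4)"
    by (intro sums_mult zeta_nat_sums) simp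
  ultimately show ?thesis by simp
qed

text \<open>
  Pairing with the shift \<open>along_shift\<close> is what makes this row summable in closed form: its logarithmic
  derivative is just \<open>-2 / (k + 1)\<close>, so no product of two harmonic numbers arises, and the half-integer
  sums appear exactly in the combination of \<open>odd_euler_sum\<close>.
\<close>
lemma row_mixed: "(\<lambda>k. deriv2 (main_term 0 k) 0 along_null along_shift) sums (12 * zeta_nat 4)"
proof -
  have "deriv2 (main_term 0 k) 0 along_null along_shift =
      - 3 * (1 / (real k + 1) ^ 4) + (- 12) * (harm k / (real k + 1) ^ 3)
      + (- 6) * (gen_harm 2 k / (real k + 1) ^ 2)
      + (2 * recip_sum 2 (Suc k) (1 / 2) / (real k + 1) ^ 2 + 4 * recip_sum 1 (Suc k) (1 / 2) / (real k + 1) ^ 3)" for k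
  proof -
    define x where "x = real k + 1"
    have x: "x \<noteq> 0" "2 + 2 * real k = 2 * x" by (auto simp: x_def)
    have L: "dlog (main_term 0 k) 0 along_null = 1 / (2 * x) + 3 * harm k - recip_sum 1 (Suc k) (1 / 2)"
      by (simp add: dlog_main recip_sum_0 harm_expand(1) x)
    have LL: "ddlog (main_term 0 k) 0 along_null along_shift
        = - 1 / (2 * x ^ 2) - 3 * gen_harm 2 k + recip_sum 2 (Suc k) (1 / 2)"
      by (simp add: ddlog_main x recip_sum_0 gen_harm_0 power2_eq_square)
    define O1 O2 where "O1 = recip_sum 1 (Suc k) (1 / 2)" and "O2 = recip_sum 2 (Suc k) (1 / 2)"
    show ?thesis
      unfolding deriv2_def val_top_row dlog_row_shift L LL x_def[symmetric] O1_def[symmetric] O2_def[symmetric]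
      using x(1) by (simp add: field_simps) (simp add: eval_nat_numeral algebra_simps)
  qed
  moreover have "(\<lambda>k. - 3 * (1 / (real k + 1) ^ 4) + (- 12) * (harm k / (real k + 1) ^ 3)
      + (- 6) * (gen_harm 2 k / (real k + 1) ^ 2)
      + (2 * recip_sum 2 (Suc k) (1 / 2) / (real k + 1) ^ 2 + 4 * recip_sum 1 (Suc k) (1 / 2) / (real k + 1) ^ 3))
    sums (- 3 * zeta_nat 4 + (- 12) * (zeta_nat 4 / 4) + (- 6) * (3 / 4 * zeta_nat 4) + 45 / 2 * zeta_nat 4)"
    by (intro sums_add sums_mult zeta_nat_sums euler_sum_3_1 euler_sum_2_2 odd_euler_sum) simp
  ultimately show ?thesis by simp
qed

section \<open>The four directions: the column\<close>

definition summand1 :: "nat \<Rightarrow> real" where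
  "summand1 k = sun_weight k * (Q k * (3 * harm (2 * k - 1) - 2 * harm (k - 1)) - 34 * real k + 25 / 2)"
definition summand2 :: "nat \<Rightarrow> real" where
  "summand2 k = sun_weight k * (Q k * harm (4 * k - 1) - (304 * real k ^ 2 - 216 * real k + 39) / (4 * (4 * real k - 1)))"
definition summand3 :: "nat \<Rightarrow> real" where
  "summand3 k = sun_weight k * (Q k * gen_harm 2 (k - 1) + (44 * real k - 15) / (4 * real k))"
definition summand4 :: "nat \<Rightarrow> real" where
  "summand4 k = sun_weight k * (Q k * gen_harm 2 (2 * k - 1) + (52 * real k - 21) / (4 * real k))"

lemma indices: "2 * Suc n - 1 = 2 * n + 1" "4 * Suc n - 1 = 4 * n + 3" "Suc n - 1 = n"
  by simp_all

lemma harm_indices: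
  "harm (2 * n + 1) = harm (2 * n) + 1 / (2 * real n + 1)"
  "harm (2 * n + 2) = harm (2 * n + 1) + 1 / (2 * real n + 2)"
  "harm (4 * n + 3) = harm (4 * n + 2) + 1 / (4 * real n + 3)"
  "harm (4 * n + 4) = harm (4 * n + 3) + 1 / (4 * real n + 4)"
proof -
  have i: "2 * n + 1 = Suc (2 * n)" "2 * n + 2 = Suc (2 * n + 1)" "4 * n + 3 = Suc (4 * n + 2)"
    "4 * n + 4 = Suc (4 * n + 3)" by simp_all
  show "harm (2 * n + 1) = harm (2 * n) + 1 / (2 * real n + 1)" unfolding i(1) harm_Suc_plus by simp
  show "harm (2 * n + 2) = harm (2 * n + 1) + 1 / (2 * real n + 2)" unfolding i(2) harm_Suc_plus by simp
  show "harm (4 * n + 3) = harm (4 * n + 2) + 1 / (4 * real n + 3)" unfolding i(3) harm_Suc_plus by simp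
  show "harm (4 * n + 4) = harm (4 * n + 3) + 1 / (4 * real n + 4)" unfolding i(4) harm_Suc_plus by simp
qed

lemma gen_harm_indices:
  "gen_harm 2 (2 * n + 1) = gen_harm 2 (2 * n) + 1 / (2 * real n + 1) ^ 2"
  "gen_harm 2 (2 * n + 2) = gen_harm 2 (2 * n + 1) + 1 / (2 * real n + 2) ^ 2"
proof -
  have i: "2 * n + 1 = Suc (2 * n)" "2 * n + 2 = Suc (2 * n + 1)" by simp_all
  show "gen_harm 2 (2 * n + 1) = gen_harm 2 (2 * n) + 1 / (2 * real n + 1) ^ 2"
    unfolding i(1) gen_harm_Suc by simp
  show "gen_harm 2 (2 * n + 2) = gen_harm 2 (2 * n + 1) + 1 / (2 * real n + 2) ^ 2"
    unfolding i(2) gen_harm_Suc by simp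
qed

text \<open>
  All sums over half-integers are expressed by \<open>H\<^bsub>k-1\<^esub>\<close>, \<open>H\<^bsub>2k-1\<^esub>\<close> and \<open>H\<^bsub>4k-1\<^esub>\<close> with \<open>k = n + 1\<close>, the harmonic
  numbers of the theorem.
\<close>
lemma recip_sum_1_columns:
  "recip_sum 1 n (1 / 2) = 2 * (harm (2 * n + 1) - 1 / (2 * real n + 1)) - harm n"
  "recip_sum 1 (n + 1) (1 / 2) = 2 * (harm (2 * n + 1) + 1 / (2 * real n + 2)) - (harm n + 1 / (real n + 1))"
  "recip_sum 1 (2 * n + 1) (1 / 2) = 2 * (harm (4 * n + 3) - 1 / (4 * real n + 3)) - harm (2 * n + 1)"
  "recip_sum 1 (2 * n + 2) (1 / 2) = 2 * (harm (4 * n + 3) + 1 / (4 * real n + 4)) - (harm (2 * n + 1) + 1 / (2 * real n + 2))"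
proof -
  have i: "2 * (n + 1) = 2 * n + 2" "2 * (2 * n + 1) = 4 * n + 2" "2 * (2 * n + 2) = 4 * n + 4" "n + 1 = Suc n"
    by simp_all
  note h = harm_indices[of n] harm_Suc_plus[of n]
  show "recip_sum 1 n (1 / 2) = 2 * (harm (2 * n + 1) - 1 / (2 * real n + 1)) - harm n"
    unfolding recip_sum_1_half h by simp
  show "recip_sum 1 (n + 1) (1 / 2) = 2 * (harm (2 * n + 1) + 1 / (2 * real n + 2)) - (harm n + 1 / (real n + 1))"
    unfolding recip_sum_1_half i(1) h(2) unfolding i(4) h(5) by simp
  show "recip_sum 1 (2 * n + 1) (1 / 2) = 2 * (harm (4 * n + 3) - 1 / (4 * real n + 3)) - harm (2 * n + 1)"
    unfolding recip_sum_1_half i(2) h(3) by simp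
  show "recip_sum 1 (2 * n + 2) (1 / 2) = 2 * (harm (4 * n + 3) + 1 / (4 * real n + 4)) - (harm (2 * n + 1) + 1 / (2 * real n + 2))"
    unfolding recip_sum_1_half i(3) h(2) h(4) by simp
qed

lemma recip_sum_2_columns:
  "recip_sum 2 n (1 / 2) = 4 * (gen_harm 2 (2 * n + 1) - 1 / (2 * real n + 1) ^ 2) - gen_harm 2 n"
  "recip_sum 2 (n + 1) (1 / 2) = 4 * (gen_harm 2 (2 * n + 1) + 1 / (2 * real n + 2) ^ 2) - (gen_harm 2 n + 1 / (real n + 1) ^ 2)"
proof -
  have i: "2 * (n + 1) = 2 * n + 2" "n + 1 = Suc n" by simp_all
  show "recip_sum 2 n (1 / 2) = 4 * (gen_harm 2 (2 * n + 1) - 1 / (2 * real n + 1) ^ 2) - gen_harm 2 n"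
    unfolding recip_sum_2_half gen_harm_indices by simp
  show "recip_sum 2 (n + 1) (1 / 2) = 4 * (gen_harm 2 (2 * n + 1) + 1 / (2 * real n + 2) ^ 2) - (gen_harm 2 n + 1 / (real n + 1) ^ 2)"
    unfolding recip_sum_2_half i(1) gen_harm_indices(2) unfolding i(2) gen_harm_Suc by simp
qed

lemma dlog_column_main:
  "dlog (main_term n 0) 0 (a, b, c, d, e) =
     a / (2 + 3 * real n) + (3 * a - b - c - d) * (harm n - harm (2 * n + 1))
     + e * recip_sum 1 (2 * n + 1) (1 / 2) - (a - e) * recip_sum 1 (n + 1) (1 / 2)
     - (2 * a - b - c - d - e) * recip_sum 1 n (1 / 2)"
  unfolding dlog_main by (simp add: algebra_simps)

lemma dlog_column_carry:
  "dlog (carry_term n 0) 0 (a, b, c, d, e) =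
     (2 * a - b - c - d) / (3 + 3 * real n) + (b + c + d) * (harm n + 1 / (real n + 1))
     - (3 * a - b - c - d) * (harm (2 * n + 1) + 1 / (2 * real n + 2)) + (3 * a - 2 * (b + c + d)) * harm n
     + e * recip_sum 1 (2 * n + 2) (1 / 2) - (a - e) * recip_sum 1 (n + 1) (1 / 2)
     - (2 * a - b - c - d - e) * recip_sum 1 (n + 1) (1 / 2)"
proof -
  have "harm (n + 0 + 1) = harm n + 1 / (real n + 1)"
    "harm (2 * n + 0 + 2) = harm (2 * n + 1) + 1 / (2 * real n + 2)"
    using harm_Suc_plus[of n] harm_indices(2)[of n] by simp_all
  then show ?thesis unfolding dlog_carry by simp
qed

lemma ddlog_column_main:
  "ddlog (main_term n 0) 0 (a, b, c, d, e) (a', b', c', d', e') =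
     - (a * a' / (2 + 3 * real n)\<^sup>2
        + (b * b' + c * c' + d * d' + (a - b - c) * (a' - b' - c') + (a - b - d) * (a' - b' - d')
            + (a - c - d) * (a' - c' - d')) * gen_harm 2 n
        + e * e' * recip_sum 2 (2 * n + 1) (1 / 2)
        - ((a - b) * (a' - b') + (a - c) * (a' - c') + (a - d) * (a' - d')) * gen_harm 2 (2 * n + 1)
        - (a - e) * (a' - e') * recip_sum 2 (n + 1) (1 / 2)
        - (2 * a - b - c - d - e) * (2 * a' - b' - c' - d' - e') * recip_sum 2 n (1 / 2))"
  unfolding ddlog_main by (simp add: algebra_simps)

lemma ddlog_column_carry:
  "ddlog (carry_term n 0) 0 (a, b, c, d, e) (a', b', c', d', e') =
     - ((2 * a - b - c - d) * (2 * a' - b' - c' - d') / (3 + 3 * real n)\<^sup>2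
        + (b * b' + c * c' + d * d') * (gen_harm 2 n + 1 / (real n + 1) ^ 2)
        + e * e' * recip_sum 2 (2 * n + 2) (1 / 2)
        - ((a - b) * (a' - b') + (a - c) * (a' - c') + (a - d) * (a' - d'))
            * (gen_harm 2 (2 * n + 1) + 1 / (2 * real n + 2) ^ 2)
        - (a - e) * (a' - e') * recip_sum 2 (n + 1) (1 / 2)
        + ((a - b - c) * (a' - b' - c') + (a - b - d) * (a' - b' - d') + (a - c - d) * (a' - c' - d')) * gen_harm 2 n
        - (2 * a - b - c - d - e) * (2 * a' - b' - c' - d' - e') * recip_sum 2 (n + 1) (1 / 2))"
proof -
  have "gen_harm 2 (n + 0 + 1) = gen_harm 2 n + 1 / (real n + 1) ^ 2"
    "gen_harm 2 (2 * n + 0 + 2) = gen_harm 2 (2 * n + 1) + 1 / (2 * real n + 2) ^ 2"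
    using gen_harm_Suc[of 2 n] gen_harm_indices(2)[of n] by simp_all
  then show ?thesis unfolding ddlog_carry by simp
qed

lemma column_u: "deriv1 (main_term n 0) 0 along_b + deriv1 (carry_term n 0) 0 along_b = summand1 (Suc n)"
proof -
  define x h1 h2 where "x = real n" and "h1 = (harm n :: real)" and "h2 = (harm (2 * n + 1) :: real)"
  have x: "0 \<le> x" by (simp add: x_def)
  have k: "real (Suc n) = x + 1" by (simp add: x_def)
  note unf = dlog_column_main dlog_column_carry recip_sum_1_columns[of n] x_def[symmetric] h1_def[symmetric] h2_def[symmetric]
  have "8 * (3 * (x + 1) - 1) * (2 * (x + 1) - 1) * dlog (main_term n 0) 0 along_b
     + 3 * (x + 1) * (4 * (x + 1) - 1) * dlog (carry_term n 0) 0 along_b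
    = (60 * (x + 1) ^ 2 - 43 * (x + 1) + 8) * (3 * h2 - 2 * h1) - 34 * (x + 1) + 25 / 2"
    unfolding unf using x by (simp add: divide_simps) algebra
  then show ?thesis
    unfolding deriv1_def base_values summand1_def Q_def indices k h1_def[symmetric] h2_def[symmetric]
    by (simp only: mult.assoc distrib_left[symmetric])
qed

lemma column_shift:
  "deriv1 (main_term n 0) 0 along_shift + deriv1 (carry_term n 0) 0 along_shift = 2 * summand2 (Suc n) - 2 * summand1 (Suc n)"
proof -
  define x h1 h2 h4 where "x = real n" and "h1 = (harm n :: real)" and "h2 = (harm (2 * n + 1) :: real)"
    and "h4 = (harm (4 * n + 3) :: real)"
  have x: "0 \<le> x" by (simp add: x_def)
  have k: "real (Suc n) = x + 1" by (simp add: x_def)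
  note unf = dlog_column_main dlog_column_carry recip_sum_1_columns[of n] x_def[symmetric] h1_def[symmetric] h2_def[symmetric]
    h4_def[symmetric]
  have F: "dlog (main_term n 0) 0 along_shift = 2 / (2 + 3 * x) - 2 / (4 * x + 3) + 2 * h4 - 6 * h2 + 4 * h1"
    unfolding unf using x by (simp add: divide_simps) algebra
  have M: "dlog (carry_term n 0) 0 along_shift = 11 / 6 / (x + 1) + 2 * h4 - 6 * h2 + 4 * h1"
    unfolding unf using x by (simp add: divide_simps) algebra
  have "8 * (3 * (x + 1) - 1) * (2 * (x + 1) - 1) * dlog (main_term n 0) 0 along_shift
     + 3 * (x + 1) * (4 * (x + 1) - 1) * dlog (carry_term n 0) 0 along_shift
    = 2 * ((60 * (x + 1) ^ 2 - 43 * (x + 1) + 8) * h4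
           - (304 * (x + 1) ^ 2 - 216 * (x + 1) + 39) / (4 * (4 * (x + 1) - 1)))
      - 2 * ((60 * (x + 1) ^ 2 - 43 * (x + 1) + 8) * (3 * h2 - 2 * h1) - 34 * (x + 1) + 25 / 2)"
    unfolding F M using x by (simp add: divide_simps) algebra
  then show ?thesis
    unfolding deriv1_def base_values summand1_def summand2_def Q_def indices k h1_def[symmetric] h2_def[symmetric] h4_def[symmetric]
    by (simp only: mult.assoc mult.left_commute[of 2 "sun_weight _"] distrib_left[symmetric] right_diff_distrib[symmetric])
qed

lemma column_split:
  "deriv2 (main_term n 0) 0 along_split along_split + deriv2 (carry_term n 0) 0 along_split along_split
    = 2 * summand4 (Suc n) - 4 * summand3 (Suc n)"
proof -
  define x h1 h2 where "x = real n" and "h1 = gen_harm 2 n" and "h2 = gen_harm 2 (2 * n + 1)"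
  have x: "0 \<le> x" by (simp add: x_def)
  have k: "real (Suc n) = x + 1" by (simp add: x_def)
  note unf = ddlog_column_main ddlog_column_carry recip_sum_2_columns[of n] x_def[symmetric] h1_def[symmetric] h2_def[symmetric]
  have z: "dlog (main_term n 0) 0 along_split = 0" "dlog (carry_term n 0) 0 along_split = 0"
    by (simp_all add: dlog_column_main dlog_column_carry)
  have F: "ddlog (main_term n 0) 0 along_split along_split = 2 * h2 - 4 * h1"
    unfolding unf by simp
  have M: "ddlog (carry_term n 0) 0 along_split along_split = 2 * h2 - 4 * h1 - 3 / 2 / (x + 1) ^ 2"
    unfolding unf using x by (simp add: divide_simps) algebra
  have "8 * (3 * (x + 1) - 1) * (2 * (x + 1) - 1) * ddlog (main_term n 0) 0 along_split along_split
     + 3 * (x + 1) * (4 * (x + 1) - 1) * ddlog (carry_term n 0) 0 along_split along_split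
    = 2 * ((60 * (x + 1) ^ 2 - 43 * (x + 1) + 8) * h2 + (52 * (x + 1) - 21) / (4 * (x + 1)))
      - 4 * ((60 * (x + 1) ^ 2 - 43 * (x + 1) + 8) * h1 + (44 * (x + 1) - 15) / (4 * (x + 1)))"
    unfolding F M using x by (simp add: divide_simps) algebra
  then show ?thesis
    unfolding deriv2_def z base_values summand3_def summand4_def Q_def indices k h1_def[symmetric] h2_def[symmetric]
    by (simp only: mult_zero_left add_0_left mult.assoc mult.left_commute[of 2 "sun_weight _"] mult.left_commute[of 4 "sun_weight _"]
        distrib_left[symmetric] right_diff_distrib[symmetric])
qed

text \<open>
  Along \<open>along_null\<close> both logarithmic derivatives in column 0 are rational, and weighted with the two
  polynomials of \<open>base_values\<close> they cancel. The first-order harmonic numbers \<open>L\<close>, which both terms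
  have in common along \<open>along_shift\<close>, therefore drop out of the products, and only harmonic numbers of
  order 2 remain.
\<close>
lemma column_mixed:
  "deriv2 (main_term n 0) 0 along_null along_shift + deriv2 (carry_term n 0) 0 along_null along_shift
    = 4 * summand4 (Suc n) - 4 * summand3 (Suc n)"
proof -
  define x h1 h2 g1 g2 g4 where "x = real n" and "h1 = gen_harm 2 n" and "h2 = gen_harm 2 (2 * n + 1)"
    and "g1 = (harm n :: real)" and "g2 = (harm (2 * n + 1) :: real)" and "g4 = (harm (4 * n + 3) :: real)"
  have x: "0 \<le> x" by (simp add: x_def)
  have k: "real (Suc n) = x + 1" by (simp add: x_def)
  note unf = dlog_column_main dlog_column_carry ddlog_column_main ddlog_column_carry recip_sum_1_columns[of n] recip_sum_2_columns[of n]
    x_def[symmetric] h1_def[symmetric] h2_def[symmetric] g1_def[symmetric] g2_def[symmetric] g4_def[symmetric]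
  have F_null: "dlog (main_term n 0) 0 along_null = 1 / (2 + 3 * x) - 2 / (2 * x + 1)"
    unfolding unf using x by (simp add: divide_simps) algebra
  have M_null: "dlog (carry_term n 0) 0 along_null = 8 / 3 / (x + 1)"
    unfolding unf using x by (simp add: divide_simps) algebra
  \<comment> \<open>The part that the logarithmic derivatives of both terms along \<open>along_shift\<close> have in common.\<close>
  define L where "L = 2 * g4 - 6 * g2 + 4 * g1"
  have F_shift: "dlog (main_term n 0) 0 along_shift = 2 / (2 + 3 * x) - 2 / (4 * x + 3) + L"
    unfolding unf L_def using x by (simp add: divide_simps) algebra
  have M_shift: "dlog (carry_term n 0) 0 along_shift = 11 / 6 / (x + 1) + L"
    unfolding unf L_def using x by (simp add: divide_simps) algebra
  have F: "ddlog (main_term n 0) 0 along_null along_shift = 4 * h2 - 4 * h1 - 2 / (2 + 3 * x) ^ 2"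
    unfolding unf using x by (simp add: divide_simps) algebra
  have M: "ddlog (carry_term n 0) 0 along_null along_shift = 4 * h2 - 4 * h1 - 26 / 9 / (x + 1) ^ 2"
    unfolding unf using x by (simp add: divide_simps) algebra
  have "8 * (3 * (x + 1) - 1) * (2 * (x + 1) - 1) *
        (dlog (main_term n 0) 0 along_null * dlog (main_term n 0) 0 along_shift + ddlog (main_term n 0) 0 along_null along_shift)
     + 3 * (x + 1) * (4 * (x + 1) - 1) *
        (dlog (carry_term n 0) 0 along_null * dlog (carry_term n 0) 0 along_shift + ddlog (carry_term n 0) 0 along_null along_shift)
    = 4 * ((60 * (x + 1) ^ 2 - 43 * (x + 1) + 8) * h2 + (52 * (x + 1) - 21) / (4 * (x + 1)))
      - 4 * ((60 * (x + 1) ^ 2 - 43 * (x + 1) + 8) * h1 + (44 * (x + 1) - 15) / (4 * (x + 1)))"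
    unfolding F_null M_null F_shift M_shift F M using x by (simp add: divide_simps) algebra
  then show ?thesis
    unfolding deriv2_def base_values summand3_def summand4_def Q_def indices k h1_def[symmetric] h2_def[symmetric]
    by (simp only: mult.assoc mult.left_commute[of 4 "sun_weight _"] distrib_left[symmetric] right_diff_distrib[symmetric])
qed

section \<open>The four series\<close>

lemma summand1_sums: "(\<lambda>n. summand1 (Suc n)) sums (6 * zeta_nat 3)"
  using first_order_transfer[OF row_u] unfolding column_u .

lemma summand2_sums: "(\<lambda>n. summand2 (Suc n)) sums (4 * zeta_nat 3)"
proof -
  have "(\<lambda>n. 2 * summand2 (Suc n) - 2 * summand1 (Suc n)) sums (- 4 * zeta_nat 3)"
    using first_order_transfer[OF row_shift] unfolding column_shift .
  from sums_mult[OF sums_add[OF this sums_mult[OF summand1_sums, of 2]], of "1 / 2"]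
  show ?thesis by simp
qed

lemma summand4_sums: "(\<lambda>n. summand4 (Suc n)) sums (4 * zeta_nat 4)"
proof -
  have a: "(\<lambda>n. 2 * summand4 (Suc n) - 4 * summand3 (Suc n)) sums (4 * zeta_nat 4)"
    using second_order_transfer[OF row_split] unfolding column_split .
  have b: "(\<lambda>n. 4 * summand4 (Suc n) - 4 * summand3 (Suc n)) sums (12 * zeta_nat 4)"
    using second_order_transfer[OF row_mixed] unfolding column_mixed .
  from sums_mult[OF sums_diff[OF b a], of "1 / 2"] show ?thesis by simp
qed

lemma summand3_sums: "(\<lambda>n. summand3 (Suc n)) sums zeta_nat 4"
proof -
  have a: "(\<lambda>n. 2 * summand4 (Suc n) - 4 * summand3 (Suc n)) sums (4 * zeta_nat 4)"
    using second_order_transfer[OF row_split] unfolding column_split .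
  from sums_mult[OF sums_diff[OF sums_mult[OF summand4_sums, of 2] a], of "1 / 4"] show ?thesis by simp
qed

theorem theorem1p15:
  shows "((\<lambda>n. let k = Suc n in
            real ((4 * k) choose (2 * k)) *
              (Q k * (3 * harm (2 * k - 1) - 2 * harm (k - 1)) - 34 * real k + 25 / 2)
            / ((4 * real k - 1) * real k ^ 3 * real ((2 * k) choose k) ^ 4))
         sums (6 * zeta 3))
    \<and> ((\<lambda>n. let k = Suc n in
            real ((4 * k) choose (2 * k)) *
              (Q k * harm (4 * k - 1)
                - (304 * real k ^ 2 - 216 * real k + 39) / (4 * (4 * real k - 1)))
            / ((4 * real k - 1) * real k ^ 3 * real ((2 * k) choose k) ^ 4))
         sums (4 * zeta 3))
    \<and> ((\<lambda>n. let k = Suc n in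
            real ((4 * k) choose (2 * k)) *
              (Q k * gen_harm 2 (k - 1) + (44 * real k - 15) / (4 * real k))
            / ((4 * real k - 1) * real k ^ 3 * real ((2 * k) choose k) ^ 4))
         sums (pi ^ 4 / 90))
    \<and> ((\<lambda>n. let k = Suc n in
            real ((4 * k) choose (2 * k)) *
              (Q k * gen_harm 2 (2 * k - 1) + (52 * real k - 21) / (4 * real k))
            / ((4 * real k - 1) * real k ^ 3 * real ((2 * k) choose k) ^ 4))
         sums (2 * pi ^ 4 / 45))"
  using summand1_sums summand2_sums summand3_sums summand4_sums
  unfolding summand1_def summand2_def summand3_def summand4_def sun_weight_def Let_def times_divide_eq_left zeta_3 zeta_nat_4
  by simp

end
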